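(* Let $p$ and $q$ be distinct primes with $\gcd(p-1,q-1)=4$, and let $g,h,D_0,D_1,D_2,D_3$, the polynomials $D_k(X)$, the quaternary sequence $(e_u)$ over $\mathbb{Z}_4$ and $\ell$ be as defined in the context. Let $\beta\in GR(4,4^{\ell})$ be a primitive $pq$-th root of unity. If $p\equiv 1 \pmod 8$ and $q\equiv 5\pmod 8$, then the Mattson-Solomon polynomial $G(X)$ (corresponding to $\beta$) of $(e_u)$ is $$G(X)=2\sum_{j=0}^{p-1}X^{jq}+2\sum_{j=1}^{q-1}X^{jp}+\sum_{k=0}^{3}(\rho+2-k)D_k(X),$$ where $\rho=D_1(\beta)+2D_2(\beta)+3D_3(\beta)$.
   Context: $\mathbb{Z}_m=\{0,1,\dots,m-1\}$ is the residue class ring modulo $m$. $p,q$ are distinct primes with $\gcd(p-1,q-1)=4$, and $e=(p-1)(q-1)/4$. Fix an integer $g$ that is a common primitive root of both $p$ and $q$, and an integer $h$ with $h\equiv g\pmod p$, $h\equiv 1\pmod q$. The generalized cyclotomic classes of order $4$ modulo $pq$ are $D_i=\{g^sh^i \bmod pq: s=0,1,\dots,e-1\}\subseteq\{0,\dots,pq-1\}$ for $0\le i<4$; they partition $\mathbb{Z}_{pq}^*$. Put $D_i(X)=\sum_{u\in D_i}X^u\in\mathbb{Z}_4[X]$. Let $P=\{p,2p,\dots,(q-1)p\}$, $Q=\{q,2q,\dots,(p-1)q\}$, $R=\{0\}$. The sequence $(e_u)_{u\ge 0}$ over $\mathbb{Z}_4$ of period $pq$ is: $e_u=2$ if $u\bmod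 pq\in Q\cup R$; $e_u=0$ if $u\bmod pq\in P$; $e_u=i$ if $u\bmod pq\in D_i$, $i=0,1,2,3$. $\ell$ is the multiplicative order of $2$ modulo $pq$. $GR(4,4^r)$ is the Galois ring $\mathbb{Z}_4[X]/(f(X))$ of characteristic $4$ with $4^r$ elements, where $f$ has degree $r$ and is irreducible modulo $2$. A primitive $pq$-th root of unity is a unit of multiplicative order exactly $pq$. Mattson-Solomon polynomial: for a sequence $(s_u)$ over $\mathbb{Z}_4$ of period $T=pq$ and a primitive $T$-th root of unity $\alpha\in GR(4,4^{\ell})$, the Mattson-Solomon polynomial of $(s_u)$ corresponding to $\alpha$ is $G(X)=\sum_{0\le i<T}\rho_iX^i\in GR(4,4^{\ell})[X]$ with $\rho_i=\sum_{0\le u<T}s_u\alpha^{-iu}$; it satisfies $s_u=G(\alpha^u)$ for all $u\ge 0$, and is uniquely determined modulo $X^T-1$ by this property. *)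

theory Defs
  imports "HOL-Algebra.Algebra" "HOL-Algebra.UnivPoly" "HOL-Number_Theory.Number_Theory"
begin

section \<open>The Galois ring of characteristic 4\<close>

abbreviation Z4 :: "int ring" where
  "Z4 \<equiv> residue_ring 4"

text \<open>
  Elements of \<^term>\<open>UP Z4\<close> are coefficient functions with values in \<open>{0..3}\<close>, so reduction
  modulo 2 is taken coefficientwise and lands in \<^term>\<open>UP (residue_ring 2)\<close>. The leading
  coefficient has to be a unit (e.g. 1) for the quotient by \<open>f\<close> to have \<open>4 ^ r\<close> elements.
\<close>

definition basic_irreducible :: "nat \<Rightarrow> (nat \<Rightarrow> int) \<Rightarrow> bool" where
  "basic_irreducible r f \<longleftrightarrow>
     f \<in> carrier (UP Z4) \<and> deg Z4 f = r \<and> f r \<in> Units Z4 \<and>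
     ring_irreducible\<^bsub>UP (residue_ring 2)\<^esub> (\<lambda>n. f n mod 2)"

definition GR :: "(nat \<Rightarrow> int) \<Rightarrow> (nat \<Rightarrow> int) set ring" where
  "GR f = UP Z4 Quot (PIdl\<^bsub>UP Z4\<^esub> f)"

text \<open>
  The scalar action of \<open>\<int>\<^sub>4\<close>: a residue \<open>c\<close> acts as \<open>c\<close> times the identity, which is
  well defined modulo 4 because the ring has characteristic 4.
\<close>

definition of_Z4 :: "('a, 'm) ring_scheme \<Rightarrow> int \<Rightarrow> 'a" where
  "of_Z4 S c = [c] \<cdot>\<^bsub>S\<^esub> \<one>\<^bsub>S\<^esub>"

definition poly_of_Z4 :: "('a, 'm) ring_scheme \<Rightarrow> (nat \<Rightarrow> int) \<Rightarrow> (nat \<Rightarrow> 'a)" where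
  "poly_of_Z4 S a = (\<lambda>n. of_Z4 S (a n))"

definition primitive_root_of_unity :: "('a, 'm) ring_scheme \<Rightarrow> nat \<Rightarrow> 'a \<Rightarrow> bool" where
  "primitive_root_of_unity S n \<alpha> \<longleftrightarrow> \<alpha> \<in> Units S \<and> group.ord (units_of S) \<alpha> = n"


section \<open>Generalized cyclotomic classes of order 4\<close>

definition cyc_class :: "nat \<Rightarrow> nat \<Rightarrow> int \<Rightarrow> int \<Rightarrow> nat \<Rightarrow> nat set" where
  "cyc_class p q g h i =
     {nat ((g ^ s * h ^ i) mod int (p * q)) | s. s < (p - 1) * (q - 1) div 4}"

definition cyc_poly :: "nat \<Rightarrow> nat \<Rightarrow> int \<Rightarrow> int \<Rightarrow> nat \<Rightarrow> (nat \<Rightarrow> int)" where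
  "cyc_poly p q g h i =
     (\<Oplus>\<^bsub>UP Z4\<^esub> u \<in> cyc_class p q g h i. up_ring.monom (UP Z4) \<one>\<^bsub>Z4\<^esub> u)"

text \<open>
  The unique class index in the last branch is meaningful because the four classes partition
  the units modulo \<open>p * q\<close>.
\<close>

definition quat_seq :: "nat \<Rightarrow> nat \<Rightarrow> int \<Rightarrow> int \<Rightarrow> nat \<Rightarrow> int" where
  "quat_seq p q g h u =
     (let v = u mod (p * q);
          P = {j * p | j. j \<in> {1..q - 1}};
          Q = {j * q | j. j \<in> {1..p - 1}};
          R = {0}
      in if v \<in> Q \<union> R then 2
         else if v \<in> P then 0
         else int (THE i. i < 4 \<and> v \<in> cyc_class p q g h i))"


section \<open>Mattson-Solomon polynomial\<close>

definition ms_coeff ::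
  "('a, 'm) ring_scheme \<Rightarrow> nat \<Rightarrow> (nat \<Rightarrow> int) \<Rightarrow> 'a \<Rightarrow> nat \<Rightarrow> 'a" where
  "ms_coeff S T s \<alpha> i =
     (\<Oplus>\<^bsub>S\<^esub> u \<in> {..<T}. of_Z4 S (s u) \<otimes>\<^bsub>S\<^esub> (\<alpha> [^]\<^bsub>S\<^esub> (- int (i * u))))"

definition mattson_solomon ::
  "('a, 'm) ring_scheme \<Rightarrow> nat \<Rightarrow> (nat \<Rightarrow> int) \<Rightarrow> 'a \<Rightarrow> (nat \<Rightarrow> 'a)" where
  "mattson_solomon S T s \<alpha> =
     (\<Oplus>\<^bsub>UP S\<^esub> i \<in> {..<T}. up_ring.monom (UP S) (ms_coeff S T s \<alpha> i) i)"

end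

(*
  Every element of the Galois ring is a unit or a double, since its reduction modulo 2 is a
  field. Hence if x <> 1 and x^n = 1 with n odd, then 1 - x is a unit (1 - x = 2y would give
  x^2 = 1), and so 1 + x + ... + x^(n-1) = 0. The coefficient of X^n in the Mattson-Solomon
  polynomial is 2 * sum of x^u over Q and R + sum of k D_k(x), where x = beta^(-n). If n is
  divisible by p or q, then x has order 1, q or p, the sum over a class collapses to a multiple
  of -1, and the congruences modulo 8 leave 2. If n lies in D_k, then -n lies in D_(k+2) because
  -1 lies in D_2; thus D_m(x) = D_(m+k+2)(beta), and the claim follows from
  D_0(beta) + ... + D_3(beta) = mu(pq) = 1.
*)
theory Submission
  imports Defs
begin

section \<open>The Galois ring modulo 2\<close>

text \<open>Class indices are controlled by discrete logarithms. To base g, an element g^s h^i has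
  logarithm s + i modulo p and s modulo q. As 4 divides both p - 1 and q - 1, the index i is the
  difference of the two logarithms modulo 4. This gives disjointness of the classes and
  multiplicativity of the index. It also locates -1, whose logarithms are (p-1)/2 and (q-1)/2, that
  is 0 and 2 modulo 4, so its index is 0 - 2 = 2. The constant 2 - k arises from the rotation of the
  classes: with j = m + k + 2, the sum of m D_(m+k+2)(\<beta>) becomes the sum of (j - k - 2)
  D_j(\<beta>), which is \<rho> minus k + 2 times the total of the D_j(\<beta>), and -2 = 2 modulo
  4. The ring has zero divisors, so a vanishing product with the factor 1 - x allows no cancellation
  until that factor is known to be a unit. This is why the structure of the quotient modulo 2 has to
  be settled before any sum of roots of unity.\<close>

lemma UP_principal_domain:
  assumes "field K"
  shows "principal_domain (UP K)"
proof -
  interpret K: field K by fact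
  interpret U: UP_domain K "UP K"
    by (unfold_locales)
  have "euclidean_domain (UP K) (deg K)"
  proof (unfold_locales)
    fix a b assume a: "a \<in> carrier (UP K) - {\<zero>\<^bsub>UP K\<^esub>}" and b: "b \<in> carrier (UP K) - {\<zero>\<^bsub>UP K\<^esub>}"
    let ?l = "coeff (UP K) b (deg K b)"
    \<comment> \<open>This is only pseudo-division: \<open>a\<close> is multiplied by a power of the
      leading coefficient of \<open>b\<close>. Over a field that power is a unit, and dividing it
      out leaves Euclidean division with norm \<open>deg\<close>.\<close>
    obtain q r and k :: nat where qr: "q \<in> carrier (UP K)" "r \<in> carrier (UP K)"
      "(?l [^]\<^bsub>K\<^esub> k) \<odot>\<^bsub>UP K\<^esub> a = b \<otimes>\<^bsub>UP K\<^esub> q \<oplus>\<^bsub>UP K\<^esub> r" "r = \<zero>\<^bsub>UP K\<^esub> \<or> deg K r < deg K b"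
      using U.long_div_theorem[of b a] a b by auto
    have l: "?l \<in> carrier K" "?l \<noteq> \<zero>\<^bsub>K\<^esub>"
      using b U.lcoeff_nonzero2[of b] by auto
    let ?m = "?l [^]\<^bsub>K\<^esub> k"
    have m: "?m \<in> Units K" using l by (intro K.Units_pow_closed) (simp add: K.field_Units)
    let ?c = "inv\<^bsub>K\<^esub> ?m"
    have c: "?c \<in> carrier K" "?c \<otimes>\<^bsub>K\<^esub> ?m = \<one>\<^bsub>K\<^esub>" using m by auto
    have "a = (?c \<otimes>\<^bsub>K\<^esub> ?m) \<odot>\<^bsub>UP K\<^esub> a" using a c by simp
    also have "\<dots> = ?c \<odot>\<^bsub>UP K\<^esub> (b \<otimes>\<^bsub>UP K\<^esub> q \<oplus>\<^bsub>UP K\<^esub> r)"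
      unfolding qr(3)[symmetric] using a c l by (intro U.UP_smult_assoc1) simp_all
    also have "\<dots> = b \<otimes>\<^bsub>UP K\<^esub> (?c \<odot>\<^bsub>UP K\<^esub> q) \<oplus>\<^bsub>UP K\<^esub> ?c \<odot>\<^bsub>UP K\<^esub> r"
    proof -
      have "?c \<odot>\<^bsub>UP K\<^esub> (b \<otimes>\<^bsub>UP K\<^esub> q) = b \<otimes>\<^bsub>UP K\<^esub> (?c \<odot>\<^bsub>UP K\<^esub> q)"
        using b qr c U.UP_smult_assoc2[of ?c q b] U.UP_m_comm[of b q] U.UP_m_comm[of b "?c \<odot>\<^bsub>UP K\<^esub> q"] by simp
      then show ?thesis using b c qr by (simp add: U.UP_smult_r_distr)
    qed
    finally have eq: "a = b \<otimes>\<^bsub>UP K\<^esub> (?c \<odot>\<^bsub>UP K\<^esub> q) \<oplus>\<^bsub>UP K\<^esub> ?c \<odot>\<^bsub>UP K\<^esub> r" .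
    have "?c \<odot>\<^bsub>UP K\<^esub> r = \<zero>\<^bsub>UP K\<^esub> \<or> deg K (?c \<odot>\<^bsub>UP K\<^esub> r) < deg K b"
      using qr c U.deg_smult_decr[of ?c r] by auto
    then show "\<exists>q r. q \<in> carrier (UP K) \<and> r \<in> carrier (UP K) \<and>
        a = b \<otimes>\<^bsub>UP K\<^esub> q \<oplus>\<^bsub>UP K\<^esub> r \<and> (r = \<zero>\<^bsub>UP K\<^esub> \<or> deg K r < deg K b)"
      using eq qr c by (intro exI[of _ "?c \<odot>\<^bsub>UP K\<^esub> q"] exI[of _ "?c \<odot>\<^bsub>UP K\<^esub> r"]) simp
  qed
  then interpret euclidean_domain "UP K" "deg K" .
  show ?thesis by unfold_locales
qed

text \<open>An irreducible element of a principal domain generates a maximal ideal, so together with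
  an element outside it the whole ring is generated. The Bezout identity is arranged without
  subtraction, which lets it be lifted directly from coefficients modulo 2 to coefficients modulo
  4.\<close>

lemma (in principal_domain) irreducible_comaximal:
  assumes "f \<in> carrier R" "ring_irreducible f" "a \<in> carrier R" "a \<notin> PIdl f"
  obtains v w where "v \<in> carrier R" "w \<in> carrier R" "v \<otimes> a = \<one> \<oplus> w \<otimes> f"
proof -
  interpret I: maximalideal "PIdl f" R
    using assms by (intro irreducible_imp_maximalideal)
  let ?J = "set_add R (PIdl f) (PIdl a)"
  have ideals: "ideal (PIdl f) R" "ideal (PIdl a) R"
    using assms by (simp_all add: cgenideal_ideal)
  have J: "ideal ?J R" using ideals by (rule add_ideals)
  have memJ: "x \<oplus> y \<in> ?J" if "x \<in> PIdl f" "y \<in> PIdl a" for x y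
    unfolding set_add_def' using that by blast
  have f_le: "PIdl f \<subseteq> ?J"
  proof
    fix x assume x: "x \<in> PIdl f"
    have "x \<oplus> \<zero> \<in> ?J"
      using ideals(2) x by (intro memJ) (simp_all add: additive_subgroup.zero_closed ideal.axioms(1))
    then show "x \<in> ?J" using ideal.Icarr[OF ideals(1) x] by simp
  qed
  have "\<zero> \<oplus> a \<in> ?J"
    using ideals(1) cgenideal_self[OF assms(3)]
    by (intro memJ) (simp_all add: additive_subgroup.zero_closed ideal.axioms(1))
  then have "a \<in> ?J" using assms(3) by simp
  then have "?J \<noteq> PIdl f" using assms(4) by blast
  moreover have "?J \<subseteq> carrier R" using ideal.Icarr[OF J] by blast
  ultimately have "?J = carrier R" using I.I_maximal[OF J f_le] by blast
  then have "\<one> \<in> ?J" using one_closed by (simp only:)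
  then obtain v w where v: "v \<in> carrier R" and w: "w \<in> carrier R" and one: "\<one> = w \<otimes> f \<oplus> v \<otimes> a"
    unfolding set_add_def' cgenideal_def by blast
  have "v \<otimes> a = (w \<otimes> f \<oplus> v \<otimes> a) \<oplus> (\<ominus> w) \<otimes> f"
    using v w assms(1,3) by algebra
  then have "v \<otimes> a = \<one> \<oplus> (\<ominus> w) \<otimes> f"
    by (simp only: one[symmetric])
  then show ?thesis using that[OF v a_inv_closed[OF w]] by blast
qed

lemma UP_map_ring_hom:
  assumes "cring R" "cring S" "h \<in> ring_hom R S"
  shows "(\<lambda>p n. h (p n)) \<in> ring_hom (UP R) (UP S)"
proof -
  interpret h: ring_hom_cring R S h by (rule ring_hom_cringI[OF assms])
  have up: "(\<lambda>n. h (p n)) \<in> up S" if p: "p \<in> up R" for p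
  proof -
    obtain N where "bound \<zero>\<^bsub>R\<^esub> N p" using p by (auto simp: up_def)
    then have "bound \<zero>\<^bsub>S\<^esub> N (\<lambda>n. h (p n))" by (auto simp: bound_def)
    then show ?thesis using p by (auto simp: up_def)
  qed
  show ?thesis
  proof (rule ring_hom_memI)
    fix p q assume "p \<in> carrier (UP R)" "q \<in> carrier (UP R)"
    then have pq: "p \<in> up R" "q \<in> up R" by (auto simp: UP_def)
    have [simp]: "p i \<in> carrier R" "q i \<in> carrier R" for i using pq by auto
    show "(\<lambda>n. h ((p \<otimes>\<^bsub>UP R\<^esub> q) n)) = (\<lambda>n. h (p n)) \<otimes>\<^bsub>UP S\<^esub> (\<lambda>n. h (q n))"
      using pq up by (auto simp: UP_def fun_eq_iff Pi_def intro!: h.S.finsum_cong')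
    show "(\<lambda>n. h ((p \<oplus>\<^bsub>UP R\<^esub> q) n)) = (\<lambda>n. h (p n)) \<oplus>\<^bsub>UP S\<^esub> (\<lambda>n. h (q n))"
      using pq up by (auto simp: UP_def)
  qed (use up in \<open>auto simp: UP_def fun_eq_iff\<close>)
qed

section \<open>Reduction of polynomials over \<open>Z4\<close> modulo 2\<close>

lemma cring_Z4: "cring Z4"
  using residues.cring[of 4] by (simp add: residues_def)

lemma mod_2_ring_hom: "(\<lambda>c. c mod 2) \<in> ring_hom Z4 (residue_ring 2)"
  by (rule ring_hom_memI) (auto simp: residue_ring_def mod_mult_eq mod_add_eq mod_mod_cancel)

lemma UP_Z4_carrier_iff: "a \<in> carrier (UP Z4) \<longleftrightarrow> (\<forall>n. 0 \<le> a n \<and> a n \<le> 3) \<and> (\<exists>N. bound 0 N a)"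
  by (auto simp: UP_def up_def residue_ring_def Pi_def)

lemma UP_Z4_add:
  assumes "a \<in> carrier (UP Z4)" "b \<in> carrier (UP Z4)"
  shows "a \<oplus>\<^bsub>UP Z4\<^esub> b = (\<lambda>n. (a n + b n) mod 4)"
proof -
  have "a \<oplus>\<^bsub>UP Z4\<^esub> b = (\<lambda>n. a n \<oplus>\<^bsub>Z4\<^esub> b n)"
    using assms by (simp add: UP_def)
  then show ?thesis by (simp add: residue_ring_def)
qed

text \<open>The kernel of coefficientwise reduction modulo 2 consists of the doubles; this is what
  turns an identity over the field with two elements into an identity over \<open>Z4\<close> with an
  error term 2c.\<close>

lemma UP_Z4_eq_double:
  assumes a: "a \<in> carrier (UP Z4)" and b: "b \<in> carrier (UP Z4)"
    and eq: "\<And>n. a n mod 2 = b n mod 2"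
  obtains c where "c \<in> carrier (UP Z4)" "a = b \<oplus>\<^bsub>UP Z4\<^esub> (c \<oplus>\<^bsub>UP Z4\<^esub> c)"
proof -
  interpret U: UP_cring Z4 "UP Z4" using cring_Z4 by (simp add: UP_cring_def)
  \<comment> \<open>The representative of \<open>a n - b n\<close> in {0..3} is 0 or 2 by the parity
    hypothesis, so its half is an exact witness.\<close>
  define c where "c = (\<lambda>n. ((a n - b n) mod 4) div 2)"
  obtain M N where MN: "bound 0 M a" "bound 0 N b"
    using a b by (auto simp: UP_Z4_carrier_iff)
  have "bound 0 (max M N) c"
    using MN by (auto simp: bound_def c_def)
  moreover have "0 \<le> c n \<and> c n \<le> 3" for n
  proof -
    have "0 \<le> (a n - b n) mod 4" "(a n - b n) mod 4 < 4" by simp_all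
    then show ?thesis unfolding c_def by linarith
  qed
  ultimately have c: "c \<in> carrier (UP Z4)"
    by (auto simp: UP_Z4_carrier_iff)
  have cc: "c \<oplus>\<^bsub>UP Z4\<^esub> c \<in> carrier (UP Z4)" using U.P.add.m_closed c by simp
  have "b \<oplus>\<^bsub>UP Z4\<^esub> (c \<oplus>\<^bsub>UP Z4\<^esub> c) = (\<lambda>n. (b n + (c n + c n) mod 4) mod 4)"
    unfolding UP_Z4_add[OF b cc] unfolding UP_Z4_add[OF c c] ..
  also have "\<dots> = a"
  proof
    fix n
    have "2 dvd a n - b n" using eq[of n] by (simp add: mod_eq_dvd_iff)
    then have "2 dvd (a n - b n) mod 4" by (simp add: dvd_mod_iff)
    then have "c n + c n = (a n - b n) mod 4" unfolding c_def by auto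
    then have "(b n + (c n + c n) mod 4) mod 4 = a n mod 4" by (simp add: mod_simps)
    also have "\<dots> = a n" using a by (simp add: UP_Z4_carrier_iff zmod_trivial_iff le_less_trans[of _ 3])
    finally show "(b n + (c n + c n) mod 4) mod 4 = a n" .
  qed
  finally show ?thesis using that c by metis
qed

lemma UP_Z4_quadruple:
  assumes c: "c \<in> carrier (UP Z4)"
  shows "(c \<oplus>\<^bsub>UP Z4\<^esub> c) \<oplus>\<^bsub>UP Z4\<^esub> (c \<oplus>\<^bsub>UP Z4\<^esub> c) = \<zero>\<^bsub>UP Z4\<^esub>"
proof -
  interpret U: UP_cring Z4 "UP Z4" using cring_Z4 by (simp add: UP_cring_def)
  have cc: "c \<oplus>\<^bsub>UP Z4\<^esub> c \<in> carrier (UP Z4)" using U.P.add.m_closed c by simp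
  have "(c \<oplus>\<^bsub>UP Z4\<^esub> c) \<oplus>\<^bsub>UP Z4\<^esub> (c \<oplus>\<^bsub>UP Z4\<^esub> c) = (\<lambda>n. ((c n + c n) mod 4 + (c n + c n) mod 4) mod 4)"
    unfolding UP_Z4_add[OF cc cc] unfolding UP_Z4_add[OF c c] ..
  also have "\<dots> = (\<lambda>n. 0)" by (simp add: mod_simps fun_eq_iff)
  finally show ?thesis by (simp add: UP_def residue_ring_def)
qed

text \<open>The square is 1 + 4z + 4z^2. Hence everything congruent to 1 modulo 2 is its own
  inverse, which serves both to correct an inverse modulo 2 and to square a root of unity congruent
  to 1 modulo 2.\<close>

lemma (in cring) square_one_plus_double:
  assumes z: "z \<in> carrier R" and "(z \<oplus> z) \<oplus> (z \<oplus> z) = \<zero>"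
  shows "(\<one> \<oplus> (z \<oplus> z)) \<otimes> (\<one> \<oplus> (z \<oplus> z)) = \<one>"
proof -
  let ?w = "z \<oplus> z"
  have "?w \<otimes> ?w = z \<otimes> (?w \<oplus> ?w)" using z by algebra
  then have "?w \<otimes> ?w = \<zero>" using z assms(2) by simp
  moreover have "(\<one> \<oplus> ?w) \<otimes> (\<one> \<oplus> ?w) = \<one> \<oplus> ((?w \<oplus> ?w) \<oplus> ?w \<otimes> ?w)"
    using z by algebra
  ultimately show ?thesis using assms(2) by simp
qed

section \<open>The quotient ring and its residue field\<close>

lemma cring_GR:
  assumes "f \<in> carrier (UP Z4)" shows "cring (GR f)"
proof -
  interpret UP_cring Z4 "UP Z4" using cring_Z4 by (simp add: UP_cring_def)
  show ?thesis unfolding GR_def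
    using assms by (intro ideal.quotient_is_cring cgenideal_ideal P.is_cring)
qed

lemma GR_rcos_ring_hom:
  assumes "f \<in> carrier (UP Z4)"
  shows "ring_hom_cring (UP Z4) (GR f) ((+>\<^bsub>UP Z4\<^esub>) (PIdl\<^bsub>UP Z4\<^esub> f))"
proof -
  interpret UP_cring Z4 "UP Z4" using cring_Z4 by (simp add: UP_cring_def)
  show ?thesis unfolding GR_def
    using assms by (intro ideal.rcos_ring_hom_cring cgenideal_ideal P.is_cring)
qed

lemma GR_rcos_surj:
  assumes "x \<in> carrier (GR f)"
  obtains a where "a \<in> carrier (UP Z4)" "x = PIdl\<^bsub>UP Z4\<^esub> f +>\<^bsub>UP Z4\<^esub> a"
  using assms by (auto simp: GR_def FactRing_def A_RCOSETS_def')

lemma GR_quadruple: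
  assumes "f \<in> carrier (UP Z4)" "x \<in> carrier (GR f)"
  shows "(x \<oplus>\<^bsub>GR f\<^esub> x) \<oplus>\<^bsub>GR f\<^esub> (x \<oplus>\<^bsub>GR f\<^esub> x) = \<zero>\<^bsub>GR f\<^esub>"
proof -
  interpret \<pi>: ring_hom_cring "UP Z4" "GR f" "(+>\<^bsub>UP Z4\<^esub>) (PIdl\<^bsub>UP Z4\<^esub> f)"
    by (rule GR_rcos_ring_hom[OF assms(1)])
  obtain a where a: "a \<in> carrier (UP Z4)" "x = PIdl\<^bsub>UP Z4\<^esub> f +>\<^bsub>UP Z4\<^esub> a"
    using GR_rcos_surj[OF assms(2)] .
  show ?thesis
    using arg_cong[OF UP_Z4_quadruple[OF a(1)], of "(+>\<^bsub>UP Z4\<^esub>) (PIdl\<^bsub>UP Z4\<^esub> f)"] a by simp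
qed

text \<open>Let \<open>a\<close> represent \<open>x\<close>. If \<open>red f\<close> divides
  \<open>red a\<close>, lifting the quotient gives a = u f + 2c, and \<open>x\<close> is a double.
  Otherwise the Bezout identity lifts to v a = 1 + w f + 2c, so \<open>x\<close> times the class of
  \<open>v\<close> has the form 1 + 2z, which is invertible.\<close>

lemma GR_unit_or_double:
  assumes f: "basic_irreducible r f" and x: "x \<in> carrier (GR f)"
  shows "x \<in> Units (GR f) \<or> (\<exists>y\<in>carrier (GR f). x = y \<oplus>\<^bsub>GR f\<^esub> y)"
proof -
  define red :: "(nat \<Rightarrow> int) \<Rightarrow> nat \<Rightarrow> int" where "red = (\<lambda>a n. a n mod 2)"
  let ?Z2 = "residue_ring 2"
  define \<pi> where "\<pi> = (+>\<^bsub>UP Z4\<^esub>) (PIdl\<^bsub>UP Z4\<^esub> f)"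
  have fc: "f \<in> carrier (UP Z4)" and irr: "ring_irreducible\<^bsub>UP ?Z2\<^esub> (red f)"
    using f by (auto simp: basic_irreducible_def red_def)
  interpret Z2: residues_prime 2 ?Z2
    by unfold_locales simp_all
  interpret P2: principal_domain "UP ?Z2"
    using UP_principal_domain[OF Z2.is_field] by simp
  interpret U4: UP_cring Z4 "UP Z4" using cring_Z4 by (simp add: UP_cring_def)
  have "red \<in> ring_hom (UP Z4) (UP ?Z2)"
    unfolding red_def using UP_map_ring_hom[OF cring_Z4 _ mod_2_ring_hom] Z2.is_cring by simp
  then interpret red: ring_hom_cring "UP Z4" "UP ?Z2" red
    using U4.P.is_cring P2.is_cring by (intro ring_hom_cringI)
  interpret \<pi>: ring_hom_cring "UP Z4" "GR f" \<pi>
    unfolding \<pi>_def by (rule GR_rcos_ring_hom[OF fc])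
  have \<pi>f: "\<pi> f = \<zero>\<^bsub>GR f\<^esub>"
  proof -
    interpret I: ideal "PIdl\<^bsub>UP Z4\<^esub> f" "UP Z4" using fc by (rule U4.P.cgenideal_ideal)
    show ?thesis unfolding \<pi>_def
      using I.a_rcos_const[OF U4.P.cgenideal_self[OF fc]] by (simp add: GR_def FactRing_def)
  qed
  \<comment> \<open>Coefficients over \<open>residue_ring 2\<close> are the integers 0 and 1, so
    such a polynomial is literally also one over \<open>Z4\<close>, and no lifting map is
    needed.\<close>
  have lift: "v \<in> carrier (UP Z4)" "red v = v" if "v \<in> carrier (UP ?Z2)" for v
  proof -
    have v: "v \<in> up ?Z2" using that by (simp add: UP_def)
    have vn: "v n \<in> {0..1}" for n using mem_upD[OF v, of n] by (simp add: residue_ring_def)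
    show "red v = v"
    proof
      fix n show "red v n = v n" using vn[of n] by (simp add: red_def)
    qed
    have "bound 0 n v \<Longrightarrow> v \<in> up Z4" for n
      using vn by (force simp: up_def residue_ring_def)
    then show "v \<in> carrier (UP Z4)" using v by (auto simp: UP_def up_def residue_ring_def)
  qed
  obtain a where a: "a \<in> carrier (UP Z4)" "x = \<pi> a"
    unfolding \<pi>_def using GR_rcos_surj[OF x] .
  show ?thesis
  proof (cases "red a \<in> PIdl\<^bsub>UP ?Z2\<^esub> (red f)")
    case True
    then obtain u where u: "u \<in> carrier (UP ?Z2)" "red a = u \<otimes>\<^bsub>UP ?Z2\<^esub> red f"
      by (auto simp: cgenideal_def)
    have "red a = red (u \<otimes>\<^bsub>UP Z4\<^esub> f)" using u lift fc by simp
    then obtain c where c: "c \<in> carrier (UP Z4)" "a = u \<otimes>\<^bsub>UP Z4\<^esub> f \<oplus>\<^bsub>UP Z4\<^esub> (c \<oplus>\<^bsub>UP Z4\<^esub> c)"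
      using UP_Z4_eq_double[of a "u \<otimes>\<^bsub>UP Z4\<^esub> f"] a u lift fc by (auto simp: red_def fun_eq_iff)
    then have "x = \<pi> c \<oplus>\<^bsub>GR f\<^esub> \<pi> c" using a u lift fc by (simp add: \<pi>f)
    then show ?thesis using c by auto
  next
    case False
    then obtain v w where v: "v \<in> carrier (UP ?Z2)" and w: "w \<in> carrier (UP ?Z2)"
      and eq: "v \<otimes>\<^bsub>UP ?Z2\<^esub> red a = \<one>\<^bsub>UP ?Z2\<^esub> \<oplus>\<^bsub>UP ?Z2\<^esub> w \<otimes>\<^bsub>UP ?Z2\<^esub> red f"
      using P2.irreducible_comaximal[of "red f" "red a"] fc a irr by auto
    have "red (v \<otimes>\<^bsub>UP Z4\<^esub> a) = red (\<one>\<^bsub>UP Z4\<^esub> \<oplus>\<^bsub>UP Z4\<^esub> w \<otimes>\<^bsub>UP Z4\<^esub> f)"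
      using v w lift fc a eq by simp
    then obtain c where c: "c \<in> carrier (UP Z4)"
      "v \<otimes>\<^bsub>UP Z4\<^esub> a = \<one>\<^bsub>UP Z4\<^esub> \<oplus>\<^bsub>UP Z4\<^esub> w \<otimes>\<^bsub>UP Z4\<^esub> f \<oplus>\<^bsub>UP Z4\<^esub> (c \<oplus>\<^bsub>UP Z4\<^esub> c)"
      using UP_Z4_eq_double[of "v \<otimes>\<^bsub>UP Z4\<^esub> a" "\<one>\<^bsub>UP Z4\<^esub> \<oplus>\<^bsub>UP Z4\<^esub> w \<otimes>\<^bsub>UP Z4\<^esub> f"] a v w lift fc
      by (auto simp: red_def fun_eq_iff)
    let ?t = "\<one>\<^bsub>GR f\<^esub> \<oplus>\<^bsub>GR f\<^esub> (\<pi> c \<oplus>\<^bsub>GR f\<^esub> \<pi> c)"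
    have "\<pi> v \<otimes>\<^bsub>GR f\<^esub> x = ?t"
    proof -
      have "\<pi> (v \<otimes>\<^bsub>UP Z4\<^esub> a) = ?t"
        unfolding c(2) using lift(1)[OF w] c(1) fc by (simp add: \<pi>f)
      then show ?thesis using a lift(1)[OF v] by simp
    qed
    moreover have "?t \<otimes>\<^bsub>GR f\<^esub> ?t = \<one>\<^bsub>GR f\<^esub>"
      using c(1) GR_quadruple[OF fc] by (intro \<pi>.S.square_one_plus_double) simp_all
    \<comment> \<open>Since \<open>?t\<close> is its own inverse, multiplying by it upgrades the
      inverse modulo 2 to a true inverse.\<close>
    ultimately have "(?t \<otimes>\<^bsub>GR f\<^esub> \<pi> v) \<otimes>\<^bsub>GR f\<^esub> x = \<one>\<^bsub>GR f\<^esub>"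
      using x c(1) lift(1)[OF v] by (simp add: \<pi>.S.m_assoc)
    then have "x \<in> Units (GR f)"
      using x c(1) lift(1)[OF v] \<pi>.S.m_comm unfolding Units_def
      by (auto intro!: bexI[of _ "?t \<otimes>\<^bsub>GR f\<^esub> \<pi> v"])
    then show ?thesis ..
  qed
qed

section \<open>Generalized cyclotomic classes\<close>

lemma mod_in_totatives:
  assumes "coprime a n" "n > 1" shows "a mod n \<in> totatives n"
proof -
  have c: "coprime (a mod n) n" using assms by simp
  have "a mod n \<noteq> 0"
  proof
    assume "a mod n = 0"
    with c assms(2) show False by simp
  qed
  then show ?thesis using c assms(2) by (simp add: in_totatives_iff less_imp_le)
qed

lemma primroot_pow_cong_iff:
  assumes "residue_primroot r G" "Factorial_Ring.prime r"
  shows "[G ^ a = G ^ b] (mod r) \<longleftrightarrow> [a = b] (mod r - 1)"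
  using assms by (simp add: residue_primroot_def order_divides_expdiff totient_prime)

text \<open>A shift of the exponent merely rotates the discrete logarithms; injectivity and a count
  give the bijection. The shift \<open>i\<close> is present because modulo p the elements of the
  class with index \<open>i\<close> are the powers \<open>G ^ (s + i)\<close>.\<close>

lemma primroot_shift_bij:
  assumes r: "Factorial_Ring.prime r" "residue_primroot r G"
  shows "bij_betw (\<lambda>s. G ^ (s + i) mod r) {..<r - 1} {1..<r}"
proof -
  let ?\<phi> = "\<lambda>s. G ^ (s + i) mod r"
  have r1: "r > 1" using r(1) prime_gt_1_nat by blast
  have inj: "inj_on ?\<phi> {..<r - 1}"
  proof (rule inj_onI)
    fix s t assume st: "s \<in> {..<r - 1}" "t \<in> {..<r - 1}" "?\<phi> s = ?\<phi> t"
    have "[G ^ (s + i) = G ^ (t + i)] (mod r)" using st(3) unfolding cong_def .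
    then have "[s = t] (mod r - 1)"
      unfolding primroot_pow_cong_iff[OF r(2,1)] cong_add_rcancel_nat .
    with st show "s = t" by (simp add: cong_less_modulus_unique_nat)
  qed
  have "?\<phi> s \<in> {1..<r}" for s
  proof -
    have "coprime (G ^ (s + i)) r"
      using r(2) by (simp add: residue_primroot_def coprime_commute)
    then have "?\<phi> s \<in> totatives r" using r1 by (rule mod_in_totatives)
    then show ?thesis using totatives_less[OF _ r1] by (simp add: in_totatives_iff Suc_le_eq)
  qed
  then have "?\<phi> ` {..<r - 1} = {1..<r}"
    using inj by (intro card_subset_eq) (auto simp: card_image)
  with inj show ?thesis unfolding bij_betw_def by blast
qed

text \<open>The half power y satisfies y^2 = 1, so the prime divides (y - 1)(y + 1). It cannot
  divide y - 1, because r - 1 does not divide its own half. Thus (r - 1) div 2 is the discrete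
  logarithm of -1.\<close>

lemma primroot_half_power:
  assumes "residue_primroot r G" "Factorial_Ring.prime r" "even (r - 1)"
  shows "[G ^ ((r - 1) div 2) = r - 1] (mod r)"
proof -
  let ?y = "int (G ^ ((r - 1) div 2))"
  have r: "r > 1" using assms(2) prime_gt_1_nat by blast
  then have r2: "r > 2" using assms(3) by (cases "r = 2") auto
  have "[G ^ (r - 1) = G ^ 0] (mod r)"
    unfolding primroot_pow_cong_iff[OF assms(1,2)] by (simp add: cong_def)
  then have "[?y * ?y = 1] (mod int r)"
    using assms(3) by (simp add: cong_int_iff[symmetric] power_add[symmetric] mult_2[symmetric])
  then have "int r dvd (?y - 1) * (?y + 1)"
    by (simp add: cong_iff_dvd_diff algebra_simps)
  then have "int r dvd ?y - 1 \<or> int r dvd ?y + 1"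
    using assms(2) by (simp add: prime_dvd_mult_iff)
  moreover have "\<not> int r dvd ?y - 1"
  proof
    assume "int r dvd ?y - 1"
    then have "[?y = int (G ^ 0)] (mod int r)" by (simp add: cong_iff_dvd_diff)
    then have "[(r - 1) div 2 = 0] (mod r - 1)"
      unfolding cong_int_iff primroot_pow_cong_iff[OF assms(1,2)] .
    then have "r - 1 dvd (r - 1) div 2" by (simp add: cong_0_iff)
    then show False using r2 assms(3) by (auto dest!: dvd_imp_le elim!: evenE)
  qed
  ultimately have "[?y = int (r - 1)] (mod int r)"
  proof (elim disjE)
    assume "int r dvd ?y + 1"
    then have "int r dvd ?y + 1 - int r" by (simp add: dvd_diff)
    then show ?thesis using r by (simp add: cong_iff_dvd_diff of_nat_diff algebra_simps)
  qed simp
  then show ?thesis unfolding cong_int_iff .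
qed

text \<open>The generators are naturals here, standing for \<open>g\<close> and \<open>h\<close>
  reduced modulo \<open>p * q\<close>: a single residue then serves both primes, and all congruences
  are between naturals.\<close>

locale cyclotomic_classes =
  fixes p q G H :: nat
  assumes prime_p: "Factorial_Ring.prime p" and prime_q: "Factorial_Ring.prime q" and p_neq_q: "p \<noteq> q"
    and gcd_pq: "gcd (p - 1) (q - 1) = 4"
    and primroot_p: "residue_primroot p G" and primroot_q: "residue_primroot q G"
    and H_p: "[H = G] (mod p)" and H_q: "[H = 1] (mod q)"
begin

text \<open>Because gcd(p - 1, q - 1) = 4, this number is lcm(p - 1, q - 1), the order of
  \<open>G\<close> modulo \<open>p * q\<close>.\<close>

definition e :: nat where "e = (p - 1) * (q - 1) div 4"

definition cl :: "nat \<Rightarrow> nat set" where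
  "cl i = (\<lambda>s. G ^ s * H ^ i mod (p * q)) ` {..<e}"

lemma dvd_p: "4 dvd p - 1" and dvd_q: "4 dvd q - 1"
  using gcd_pq by (metis gcd_dvd1, metis gcd_dvd2)

text \<open>Each factorization counts full periods: as s runs below \<open>e\<close>, the powers of
  \<open>G\<close> run through the nonzero residues modulo p exactly (q-1)/4 times, and through
  those modulo q exactly (p-1)/4 times.\<close>

lemma e_eq_mult_p: "e = ((q - 1) div 4) * (p - 1)" and e_eq_mult_q: "e = ((p - 1) div 4) * (q - 1)"
  unfolding e_def using dvd_div_mult[OF dvd_q, of "p - 1"] dvd_div_mult[OF dvd_p, of "q - 1"]
  by (metis mult.commute, metis)

lemma lcm_eq_e: "lcm (p - 1) (q - 1) = e"
  unfolding e_def lcm_nat_def gcd_pq by simp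

lemma e_mult_4: "4 * e = (p - 1) * (q - 1)"
  unfolding e_def using dvd_p by simp

lemma coprime_p_q: "coprime p q"
  using prime_p prime_q p_neq_q primes_coprime by blast

lemma p_gt_1: "p > 1" and q_gt_1: "q > 1"
  using prime_gt_1_nat[OF prime_p] prime_gt_1_nat[OF prime_q] .

lemma pq_gt_1: "p * q > 1"
  using p_gt_1 q_gt_1 by (metis less_1_mult)

lemma class_elem_cong_p: "[G ^ s * H ^ i = G ^ (s + i)] (mod p)"
  unfolding power_add by (intro cong_mult cong_pow H_p cong_refl)

lemma class_elem_cong_q: "[G ^ s * H ^ i = G ^ s] (mod q)"
proof -
  have "[G ^ s * H ^ i = G ^ s * 1 ^ i] (mod q)" by (intro cong_mult cong_pow H_q cong_refl)
  then show ?thesis by simp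
qed

lemma cong_mult_iff: "[a = b] (mod p * q) \<longleftrightarrow> [a = b] (mod p) \<and> [a = b] (mod q)" for a b :: nat
  using coprime_cong_mult_nat[OF _ _ coprime_p_q] cong_modulus_mult_nat
  by (metis mult.commute)

text \<open>By the Chinese remainder theorem the congruence splits at the two primes. Modulo p both
  generators agree, so exponents add; modulo q the factor \<open>H\<close> disappears.\<close>

lemma class_elem_cong_iff:
  "[G ^ s * H ^ i = G ^ t * H ^ j] (mod p * q) \<longleftrightarrow> [s + i = t + j] (mod p - 1) \<and> [s = t] (mod q - 1)"
proof -
  have "[G ^ s * H ^ i = G ^ t * H ^ j] (mod p) \<longleftrightarrow> [G ^ (s + i) = G ^ (t + j)] (mod p)"
    using class_elem_cong_p by (meson cong_sym cong_trans)
  moreover have "[G ^ s * H ^ i = G ^ t * H ^ j] (mod q) \<longleftrightarrow> [G ^ s = G ^ t] (mod q)"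
    using class_elem_cong_q by (meson cong_sym cong_trans)
  ultimately show ?thesis
    by (simp add: cong_mult_iff primroot_pow_cong_iff primroot_p primroot_q prime_p prime_q)
qed

lemma class_index_cong:
  assumes "[G ^ s * H ^ i = G ^ t * H ^ j] (mod p * q)"
  shows "[i = j] (mod 4)"
proof -
  have "[s + i = t + j] (mod 4)" "[s = t] (mod 4)"
    using assms cong_dvd_modulus_nat[OF _ dvd_p] cong_dvd_modulus_nat[OF _ dvd_q]
    unfolding class_elem_cong_iff by metis+
  then have "[s + i = s + j] (mod 4)"
    using cong_add[OF \<open>[s = t] (mod 4)\<close> cong_refl[of j]] by (meson cong_sym cong_trans)
  then show ?thesis by (simp add: cong_add_lcancel_nat)
qed

lemma inj_on_class: "inj_on (\<lambda>s. G ^ s * H ^ i mod (p * q)) {..<e}"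
proof (rule inj_onI)
  fix s t assume st: "s \<in> {..<e}" "t \<in> {..<e}"
    and "G ^ s * H ^ i mod (p * q) = G ^ t * H ^ i mod (p * q)"
  then have "[G ^ s * H ^ i = G ^ t * H ^ i] (mod p * q)" by (simp add: cong_def)
  then have "[s = t] (mod p - 1)" "[s = t] (mod q - 1)"
    by (simp_all add: class_elem_cong_iff cong_add_rcancel_nat)
  then have "[s = t] (mod e)"
    unfolding lcm_eq_e[symmetric] by (simp add: cong_cong_lcm_nat)
  with st show "s = t" by (simp add: cong_less_modulus_unique_nat)
qed

lemma card_class: "card (cl i) = e"
  unfolding cl_def using inj_on_class by (simp add: card_image)

lemma finite_class [simp]: "finite (cl i)"
  unfolding cl_def by simp

lemma coprime_class_elem: "coprime (G ^ s * H ^ i) (p * q)"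
proof -
  have "coprime G p" "coprime G q"
    using primroot_p primroot_q by (auto simp: residue_primroot_def coprime_commute)
  moreover have "coprime H p" "coprime H q"
    using \<open>coprime G p\<close> H_p H_q by (auto simp: cong_sym cong_imp_coprime[of G H p] cong_imp_coprime[of 1 H q])
  ultimately show ?thesis by simp
qed

lemma class_subset: "cl i \<subseteq> totatives (p * q)"
  unfolding cl_def using mod_in_totatives[OF coprime_class_elem pq_gt_1] by blast

lemma class_index_unique:
  assumes "u \<in> cl i" "u \<in> cl j" shows "[i = j] (mod 4)"
proof -
  obtain s t where "u = G ^ s * H ^ i mod (p * q)" "u = G ^ t * H ^ j mod (p * q)"
    using assms unfolding cl_def by (elim imageE) blast
  then have "[G ^ s * H ^ i = G ^ t * H ^ j] (mod p * q)" by (metis cong_def)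
  then show ?thesis by (rule class_index_cong)
qed

lemma class_disjoint:
  assumes "i < 4" "j < 4" "i \<noteq> j" shows "cl i \<inter> cl j = {}"
proof (rule ccontr)
  assume "cl i \<inter> cl j \<noteq> {}"
  then have "[i = j] (mod 4)" using class_index_unique by blast
  then show False using assms by (simp add: cong_def)
qed

text \<open>A count suffices: four disjoint sets of size \<open>e\<close> inside the totatives, with
  4e = (p-1)(q-1) = \<open>totient (p * q)\<close>.\<close>

lemma Union_class: "(\<Union>i<4. cl i) = totatives (p * q)"
proof (rule card_subset_eq)
  have "card (\<Union>i<4. cl i) = (\<Sum>i<4. card (cl i))"
    by (rule card_UN_disjoint) (auto simp: class_disjoint)
  also have "\<dots> = totient (p * q)"
    using e_mult_4 coprime_p_q prime_p prime_q by (simp add: card_class totient_mult_coprime totient_prime)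
  finally show "card (\<Union>i<4. cl i) = card (totatives (p * q))"
    by (simp add: totient_def)
qed (use class_subset in auto)

text \<open>Writing \<open>H ^ 4\<close> as a power of \<open>G\<close> is avoided: the element is a
  totative, hence lies in some class with index below 4, and the congruence of indices leaves only
  \<open>i mod 4\<close>.\<close>

lemma class_elem_mod_mem: "G ^ s * H ^ i mod (p * q) \<in> cl (i mod 4)"
proof -
  have "G ^ s * H ^ i mod (p * q) \<in> totatives (p * q)"
    by (rule mod_in_totatives[OF coprime_class_elem pq_gt_1])
  then obtain j where j: "j < 4" "G ^ s * H ^ i mod (p * q) \<in> cl j"
    unfolding Union_class[symmetric] by auto
  then obtain t where "[G ^ s * H ^ i = G ^ t * H ^ j] (mod p * q)"
    by (auto simp: cl_def cong_def)
  from class_index_cong[OF this] j show ?thesis by (simp add: cong_def)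
qed

lemma class_mult:
  assumes "u \<in> cl i" "v \<in> cl j" shows "u * v mod (p * q) \<in> cl ((i + j) mod 4)"
proof -
  obtain s t where "u = G ^ s * H ^ i mod (p * q)" "v = G ^ t * H ^ j mod (p * q)"
    using assms by (auto simp: cl_def)
  then have "u * v mod (p * q) = G ^ (s + t) * H ^ (i + j) mod (p * q)"
    by (simp add: power_add mod_mult_eq mult_ac)
  then show ?thesis using class_elem_mod_mem by metis
qed

lemma class_mult_bij:
  assumes "u \<in> cl i"
  shows "bij_betw (\<lambda>v. u * v mod (p * q)) (cl j) (cl ((i + j) mod 4))"
proof -
  have "coprime u (p * q)" using assms class_subset[of i] in_totatives_iff by blast
  have inj: "inj_on (\<lambda>v. u * v mod (p * q)) (cl j)"
  proof (rule inj_onI)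
    fix v w assume vw: "v \<in> cl j" "w \<in> cl j" "u * v mod (p * q) = u * w mod (p * q)"
    then have "[v = w] (mod p * q)"
      using \<open>coprime u (p * q)\<close> by (simp add: cong_def[symmetric] cong_mult_lcancel_nat)
    moreover have "v < p * q" "w < p * q"
      using vw class_subset pq_gt_1 totatives_less by blast+
    ultimately show "v = w" by (simp add: cong_less_modulus_unique_nat)
  qed
  moreover have "(\<lambda>v. u * v mod (p * q)) ` cl j = cl ((i + j) mod 4)"
    by (rule card_subset_eq)
      (use class_mult[OF assms] inj in \<open>auto simp: card_image card_class\<close>)
  ultimately show ?thesis by (simp add: bij_betw_def)
qed

text \<open>For j the class index and t the exponent of \<open>G\<close>, comparison of logarithms
  gives t + j = (p-1)/2 and t = (q-1)/2 modulo 4. The congruences modulo 8 make these 0 and 2, which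
  forces j = 2.\<close>

lemma minus_one_class:
  assumes "[p = 1] (mod 8)" "[q = 5] (mod 8)"
  shows "p * q - 1 \<in> cl 2"
proof -
  have "p * q - 1 \<in> totatives (p * q)"
    using minus_one_in_totatives[of "p * q"] pq_gt_1 by simp
  then obtain j t where j: "j < 4" "p * q - 1 = G ^ t * H ^ j mod (p * q)"
    unfolding Union_class[symmetric] by (auto simp: cl_def)
  then have c: "[G ^ t * H ^ j = p * q - 1] (mod p * q)" by (simp add: cong_def)
  have m: "[p * q - 1 = p - 1] (mod p)" "[p * q - 1 = q - 1] (mod q)"
    using p_gt_1 q_gt_1 by (auto simp: cong_int_iff[symmetric] of_nat_diff cong_iff_dvd_diff algebra_simps)
  have "[G ^ (t + j) = p - 1] (mod p)" "[G ^ t = q - 1] (mod q)"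
    using c m class_elem_cong_p[of t j] class_elem_cong_q[of t j] unfolding cong_mult_iff
    by (meson cong_sym cong_trans)+
  then have "[G ^ (t + j) = G ^ ((p - 1) div 2)] (mod p)" "[G ^ t = G ^ ((q - 1) div 2)] (mod q)"
    using primroot_half_power[OF primroot_p prime_p] primroot_half_power[OF primroot_q prime_q]
      dvd_p dvd_q by (meson cong_sym cong_trans dvd_trans even_numeral)+
  then have "[t + j = (p - 1) div 2] (mod p - 1)" "[t = (q - 1) div 2] (mod q - 1)"
    by (simp_all add: primroot_pow_cong_iff primroot_p primroot_q prime_p prime_q)
  then have "[t + j = (p - 1) div 2] (mod 4)" "[t = (q - 1) div 2] (mod 4)"
    using cong_dvd_modulus_nat[OF _ dvd_p] cong_dvd_modulus_nat[OF _ dvd_q] by metis+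
  moreover have "(p - 1) div 2 mod 4 = 0" "(q - 1) div 2 mod 4 = 2"
  proof -
    have "p mod 8 = 1" "q mod 8 = 5" using assms by (simp_all add: cong_def)
    then show "(p - 1) div 2 mod 4 = 0" "(q - 1) div 2 mod 4 = 2" by presburger+
  qed
  ultimately have "(t + j) mod 4 = 0" "t mod 4 = 2" by (simp_all add: cong_def)
  with j(1) have "j = 2" by presburger
  then show ?thesis using j(2) class_elem_mod_mem[of t 2] by simp
qed


section \<open>Splitting the residues modulo \<open>p * q\<close> into multiples of the primes and
  units\<close>

lemma p_pos: "p > 0" and q_pos: "q > 0"
  using p_gt_1 q_gt_1 by simp_all

text \<open>\<open>Qm\<close> is the set \<open>Q \<union> R\<close> of the paper, \<open>Pm\<close> its set \<open>P\<close>.\<close>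

definition Qm :: "nat set" where "Qm = (\<lambda>j. j * q) ` {..<p}"
definition Pm :: "nat set" where "Pm = (\<lambda>j. j * p) ` {1..<q}"

lemma finite_Qm [simp]: "finite Qm" and finite_Pm [simp]: "finite Pm"
  by (simp_all add: Qm_def Pm_def)

lemma Qm_iff: "u \<in> Qm \<longleftrightarrow> u < p * q \<and> q dvd u"
proof
  assume "u \<in> Qm"
  then show "u < p * q \<and> q dvd u" using q_pos by (auto simp: Qm_def)
next
  assume u: "u < p * q \<and> q dvd u"
  then obtain j where "u = j * q" by (metis dvd_def mult.commute)
  then show "u \<in> Qm" using u by (auto simp: Qm_def)
qed

lemma Pm_iff: "u \<in> Pm \<longleftrightarrow> u < p * q \<and> p dvd u \<and> u > 0"
proof
  assume "u \<in> Pm"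
  then show "u < p * q \<and> p dvd u \<and> u > 0" using p_pos by (auto simp: Pm_def mult.commute)
next
  assume u: "u < p * q \<and> p dvd u \<and> u > 0"
  then obtain j where j: "u = j * p" by (metis dvd_def mult.commute)
  then have "j < q" "1 \<le> j" using u p_pos by (auto simp: mult.commute Suc_le_eq)
  then show "u \<in> Pm" using j by (auto simp: Pm_def)
qed

lemma totatives_pq_iff: "u \<in> totatives (p * q) \<longleftrightarrow> u < p * q \<and> \<not> p dvd u \<and> \<not> q dvd u"
proof -
  have "u \<in> totatives (p * q) \<longleftrightarrow> u < p * q \<and> u > 0 \<and> coprime u p \<and> coprime u q"
  proof
    assume u: "u \<in> totatives (p * q)"
    then show "u < p * q \<and> u > 0 \<and> coprime u p \<and> coprime u q"
      using totatives_less[OF u pq_gt_1] by (simp add: in_totatives_iff)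
  qed (simp add: in_totatives_iff)
  moreover have "coprime u r \<longleftrightarrow> \<not> r dvd u" if "Factorial_Ring.prime r" for r
    using prime_imp_coprime[OF that, of u] coprime_common_divisor[of u r r] not_prime_unit that
    by (metis coprime_commute dvd_refl)
  ultimately show ?thesis using prime_p prime_q by (metis dvd_0_right gr0I)
qed

lemma residues_partition: "{..<p * q} = Qm \<union> Pm \<union> (\<Union>m<4. cl m)"
proof -
  have "u < p * q \<longleftrightarrow> u \<in> Qm \<or> u \<in> Pm \<or> u \<in> totatives (p * q)" for u
    unfolding Qm_iff Pm_iff totatives_pq_iff by (cases "u = 0") auto
  then show ?thesis unfolding Union_class by blast
qed

lemma Qm_Pm_disjoint: "Qm \<inter> Pm = {}"
proof -
  have False if "u < p * q" "q dvd u" "p dvd u" "u > 0" for u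
  proof -
    have "p * q dvd u" using that coprime_p_q by (simp add: divides_mult)
    then show False using that by (simp add: nat_dvd_not_less)
  qed
  then show ?thesis unfolding disjoint_iff Qm_iff Pm_iff by blast
qed

lemma Qm_Pm_class_disjoint: "(Qm \<union> Pm) \<inter> (\<Union>m<4. cl m) = {}"
  unfolding Union_class by (auto simp: Qm_iff Pm_iff totatives_pq_iff)

end

section \<open>Sums of powers of roots of unity\<close>

text \<open>The value at \<open>x\<close> of the polynomial whose exponents are the elements of
  \<open>A\<close>; for \<open>A = cl k\<close> it is D_k(x), without reference to formal
  polynomials.\<close>

definition power_sum :: "('a, 'm) ring_scheme \<Rightarrow> nat set \<Rightarrow> 'a \<Rightarrow> 'a" where
  "power_sum R A x = (\<Oplus>\<^bsub>R\<^esub>u\<in>A. x [^]\<^bsub>R\<^esub> u)"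

context cring
begin

lemma of_Z4_closed [simp, intro]: "of_Z4 R c \<in> carrier R"
  by (simp add: of_Z4_def)

lemma of_Z4_add: "of_Z4 R (c + d) = of_Z4 R c \<oplus> of_Z4 R d"
  unfolding of_Z4_def add_pow_def using add.int_pow_mult[OF one_closed] by (simp add: add_pow_def)

lemma of_Z4_mult: "of_Z4 R (c * d) = of_Z4 R c \<otimes> of_Z4 R d"
proof -
  have "of_Z4 R c \<otimes> of_Z4 R d = [c] \<cdot> ([d] \<cdot> \<one>)"
    unfolding of_Z4_def by (simp add: add_pow_ldistr_int)
  also have "\<dots> = of_Z4 R (c * d)"
    unfolding of_Z4_def using add.int_pow_pow[OF one_closed] by (simp add: add_pow_def mult.commute)
  finally show ?thesis ..
qed

lemma of_Z4_0 [simp]: "of_Z4 R 0 = \<zero>"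
  by (simp add: of_Z4_def add_pow_def int_pow_def2)

lemma of_Z4_1 [simp]: "of_Z4 R 1 = \<one>"
  by (simp add: of_Z4_def add_pow_def int_pow_def2)

lemma of_Z4_minus: "of_Z4 R (- c) = \<ominus> of_Z4 R c"
  using of_Z4_add[of "- c" c] minus_equality[of "of_Z4 R (- c)" "of_Z4 R c"] by simp

lemma nat_add_pow_eq_of_Z4: "x \<in> carrier R \<Longrightarrow> [(n::nat)] \<cdot> x = of_Z4 R (int n) \<otimes> x"
  unfolding of_Z4_def by (simp add: add_pow_ldistr_int) (simp add: add_pow_def int_pow_int)

lemma pow_cong:
  assumes "x \<in> carrier R" "x [^] (n::nat) = \<one>" "[a = b] (mod n)"
  shows "x [^] a = x [^] b"
proof -
  have red: "x [^] c = x [^] (c mod n)" for c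
  proof -
    have "x [^] c = x [^] (n * (c div n) + c mod n)" by simp
    also have "\<dots> = (x [^] n) [^] (c div n) \<otimes> x [^] (c mod n)"
      using assms(1) by (simp add: nat_pow_mult nat_pow_pow)
    finally show ?thesis using assms(1,2) by simp
  qed
  show ?thesis using red[of a] red[of b] assms(3) by (simp add: cong_def)
qed

text \<open>As \<open>k\<close> is invertible modulo \<open>r\<close>, the element \<open>x\<close>
  is itself a power of \<open>x [^] k\<close>.\<close>

lemma pow_neq_one:
  assumes x: "x \<in> carrier R" "x [^] (r::nat) = \<one>" "x \<noteq> \<one>" and "coprime k r"
  shows "x [^] k \<noteq> \<one>"
proof
  assume one: "x [^] k = \<one>"
  obtain m where m: "[k * m = 1] (mod r)"
    using cong_solve_coprime_nat[OF \<open>coprime k r\<close>] by auto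
  have "x = x [^] (1::nat)" using x by simp
  also have "\<dots> = x [^] (k * m)" using pow_cong[OF x(1,2) m] by simp
  also have "\<dots> = (x [^] k) [^] m" using x by (simp add: nat_pow_pow)
  finally show False using one x(3) by simp
qed

lemma power_sum_closed [simp, intro]: "x \<in> carrier R \<Longrightarrow> power_sum R A x \<in> carrier R"
  unfolding power_sum_def by (intro finsum_closed) auto

lemma power_sum_bij:
  assumes "bij_betw \<phi> A B" "x \<in> carrier R" "\<And>u. u \<in> A \<Longrightarrow> x [^] \<phi> u = y [^] u"
  shows "power_sum R A y = power_sum R B x"
proof -
  have "power_sum R B x = (\<Oplus>u\<in>\<phi> ` A. x [^] u)"
    using assms(1) by (simp add: power_sum_def bij_betw_def)
  also have "\<dots> = (\<Oplus>u\<in>A. x [^] \<phi> u)"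
    using assms by (intro finsum_reindex) (auto simp: bij_betw_def)
  also have "\<dots> = power_sum R A y"
    unfolding power_sum_def using assms(2) by (intro finsum_cong) (auto simp: simp_implies_def assms(3))
  finally show ?thesis ..
qed

lemma power_sum_image_mult:
  assumes "x \<in> carrier R" "k > 0"
  shows "power_sum R ((\<lambda>j. j * k) ` A) x = power_sum R A (x [^] k)"
proof -
  have "bij_betw (\<lambda>j. j * k) A ((\<lambda>j. j * k) ` A)"
    using assms(2) by (auto simp: bij_betw_def inj_on_def)
  then show ?thesis
    using power_sum_bij[of "\<lambda>j. j * k" A _ x "x [^] k"] assms(1) by (simp add: nat_pow_pow mult.commute)
qed

lemma power_sum_one: "finite A \<Longrightarrow> power_sum R A \<one> = of_Z4 R (int (card A))"
  unfolding power_sum_def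
  by (induction A rule: finite_induct) (simp_all add: of_Z4_add)

lemma power_sum_Un_disjoint:
  assumes "finite A" "finite B" "A \<inter> B = {}" "x \<in> carrier R"
  shows "power_sum R (A \<union> B) x = power_sum R A x \<oplus> power_sum R B x"
  unfolding power_sum_def using assms by (intro finsum_Un_disjoint) auto

lemma geometric_sum:
  assumes x: "x \<in> carrier R"
  shows "(\<one> \<ominus> x) \<otimes> power_sum R {..<n} x = \<one> \<ominus> x [^] n"
proof (induction n)
  case 0
  show ?case using x by (simp add: power_sum_def minus_eq r_neg)
next
  case (Suc n)
  have "power_sum R {..<Suc n} x = power_sum R {..<n} x \<oplus> x [^] n"
    using power_sum_Un_disjoint[of "{..<n}" "{n}" x] x by (simp add: lessThan_Suc Un_commute power_sum_def)
  then have "(\<one> \<ominus> x) \<otimes> power_sum R {..<Suc n} x = (\<one> \<ominus> x [^] n) \<oplus> (\<one> \<ominus> x) \<otimes> x [^] n"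
    using x Suc.IH by (simp add: r_distr)
  also have "\<dots> = \<one> \<ominus> x [^] n \<otimes> x"
  proof -
    define y where "y = x [^] n"
    have "y \<in> carrier R" unfolding y_def using x by simp
    then show ?thesis unfolding y_def[symmetric] using x by algebra
  qed
  finally show ?case by simp
qed

lemma periodic_sum:
  assumes f: "\<And>s. f s \<in> carrier R" and per: "\<And>s. f (s + d) = f s"
  shows "(\<Oplus>s\<in>{..<m * d}. f s) = of_Z4 R (int m) \<otimes> (\<Oplus>s\<in>{..<d}. f s)"
proof (induction m)
  case 0
  show ?case using f by simp
next
  case (Suc m)
  have per': "f (s + m * d) = f s" for s
  proof (induction m)
    case (Suc m)
    then show ?case using per[of "s + m * d"] by (simp add: algebra_simps)
  qed simp
  have un: "{..<Suc m * d} = {..<m * d} \<union> (\<lambda>s. s + m * d) ` {..<d}"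
  proof -
    have "u \<in> (\<lambda>s. s + m * d) ` {..<d}" if "u < Suc m * d" "\<not> u < m * d" for u
      using that by (intro image_eqI[of _ _ "u - m * d"]) auto
    then show ?thesis by auto
  qed
  have "(\<Oplus>s\<in>{..<Suc m * d}. f s) = (\<Oplus>s\<in>{..<m * d}. f s) \<oplus> (\<Oplus>s\<in>(\<lambda>s. s + m * d) ` {..<d}. f s)"
    unfolding un using f by (intro finsum_Un_disjoint) auto
  also have "(\<Oplus>s\<in>(\<lambda>s. s + m * d) ` {..<d}. f s) = (\<Oplus>s\<in>{..<d}. f s)"
    using f by (subst finsum_reindex) (auto simp: per' inj_on_def)
  finally show ?case
    using f Suc.IH by (simp add: of_Z4_add l_distr a_comm)
qed

end

text \<open>Two properties of the Galois ring are abstracted, 4 = 0 and the dichotomy between units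
  and doubles; the sums of roots of unity are computed from these alone, away from cosets of
  polynomials.\<close>

locale unit_or_double_ring = cring +
  assumes quadruple: "x \<in> carrier R \<Longrightarrow> (x \<oplus> x) \<oplus> (x \<oplus> x) = \<zero>"
    and unit_or_double: "x \<in> carrier R \<Longrightarrow> x \<in> Units R \<or> (\<exists>y\<in>carrier R. x = y \<oplus> y)"
begin

lemma of_Z4_4: "of_Z4 R 4 = \<zero>"
proof -
  have "of_Z4 R ((1 + 1) + (1 + 1)) = (\<one> \<oplus> \<one>) \<oplus> (\<one> \<oplus> \<one>)"
    by (simp only: of_Z4_add of_Z4_1)
  then show ?thesis using quadruple[of \<one>] by simp
qed

lemma of_Z4_cong:
  assumes "[c = d] (mod 4)" shows "of_Z4 R c = of_Z4 R d"
proof -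
  obtain k where "d = c + 4 * k" using assms by (auto simp: cong_iff_lin)
  then show ?thesis by (simp add: of_Z4_add of_Z4_mult of_Z4_4)
qed

text \<open>If \<open>1 - x\<close> were a double, then \<open>x\<^sup>2 = 1\<close>; as \<open>n\<close> is odd, \<open>1 - x\<close> is a unit.\<close>

lemma root_of_unity_sum:
  assumes x: "x \<in> carrier R" "x [^] n = \<one>" "x \<noteq> \<one>" and "odd n"
  shows "power_sum R {..<n} x = \<zero>"
proof -
  have "\<one> \<ominus> x \<in> Units R"
  proof (rule ccontr)
    assume "\<one> \<ominus> x \<notin> Units R"
    then obtain y where y: "y \<in> carrier R" "\<one> \<ominus> x = y \<oplus> y"
      using unit_or_double[of "\<one> \<ominus> x"] x by auto
    have "x = \<one> \<ominus> (\<one> \<ominus> x)" using x by algebra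
    also have "\<dots> = \<one> \<oplus> (\<ominus> y \<oplus> \<ominus> y)" unfolding y(2) using y(1) by algebra
    finally have xx: "x \<otimes> x = \<one>"
      using square_one_plus_double[of "\<ominus> y"] quadruple[of "\<ominus> y"] y(1) by simp
    then have "x [^] (2::nat) = \<one>" using x by (simp add: numeral_2_eq_2)
    moreover have "[n = 1] (mod 2)" using \<open>odd n\<close> by (simp add: cong_def odd_iff_mod_2_eq_one)
    ultimately have "x [^] n = x [^] (1::nat)" using pow_cong x(1) by blast
    then show False using x by simp
  qed
  moreover have "(\<one> \<ominus> x) \<otimes> power_sum R {..<n} x = (\<one> \<ominus> x) \<otimes> \<zero>"
    unfolding geometric_sum[OF x(1)] x(2) using x(1) by (simp add: minus_eq r_neg)
  ultimately show ?thesis using x(1) Units_l_cancel[of "\<one> \<ominus> x" "power_sum R {..<n} x" \<zero>] by blast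
qed

lemma root_of_unity_sum_nonzero:
  assumes "x \<in> carrier R" "x [^] n = \<one>" "x \<noteq> \<one>" "odd n"
  shows "power_sum R {1..<n} x = \<ominus> \<one>"
proof -
  have "{..<n} = {0} \<union> {1..<n}" using \<open>odd n\<close> by (auto elim!: oddE)
  then have "\<one> \<oplus> power_sum R {1..<n} x = \<zero>"
    using power_sum_Un_disjoint[of "{0}" "{1..<n}" x] root_of_unity_sum[OF assms] assms(1)
    by (simp add: power_sum_def)
  then have "power_sum R {1..<n} x \<oplus> \<one> = \<zero>" using assms(1) by (simp add: a_comm)
  then show ?thesis using minus_equality[of "power_sum R {1..<n} x" \<one>] assms(1) by simp
qed

text \<open>Over one period of length r - 1 the exponents meet every nonzero residue modulo
  \<open>r\<close> once, which contributes -1; there are \<open>m\<close> periods.\<close>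

lemma primroot_power_sum:
  assumes r: "Factorial_Ring.prime r" "odd r" "residue_primroot r G"
    and x: "x \<in> carrier R" "x [^] r = \<one>" "x \<noteq> \<one>"
  shows "(\<Oplus>s\<in>{..<m * (r - 1)}. x [^] (G ^ (s + i))) = of_Z4 R (- int m)"
proof -
  let ?\<phi> = "\<lambda>s. G ^ (s + i) mod r"
  have bij: "bij_betw ?\<phi> {..<r - 1} {1..<r}"
    by (rule primroot_shift_bij[OF r(1,3)])
  have "(\<Oplus>s\<in>{..<r - 1}. x [^] (G ^ (s + i))) = (\<Oplus>s\<in>{..<r - 1}. x [^] ?\<phi> s)"
  proof (intro finsum_cong' refl)
    fix s
    show "x [^] (G ^ (s + i)) = x [^] ?\<phi> s"
      by (rule pow_cong[OF x(1,2)]) (simp add: cong_def)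
  qed (use x in simp)
  also have "\<dots> = (\<Oplus>u\<in>?\<phi> ` {..<r - 1}. x [^] u)"
    using bij x(1) by (intro finsum_reindex[symmetric]) (auto simp: bij_betw_def)
  also have "\<dots> = power_sum R {1..<r} x"
    using bij by (simp add: bij_betw_def power_sum_def)
  also have "\<dots> = \<ominus> \<one>" by (rule root_of_unity_sum_nonzero[OF x r(2)])
  finally have base: "(\<Oplus>s\<in>{..<r - 1}. x [^] (G ^ (s + i))) = \<ominus> \<one>" .
  have per: "x [^] (G ^ (s + (r - 1) + i)) = x [^] (G ^ (s + i))" for s
  proof (rule pow_cong[OF x(1,2)])
    show "[G ^ (s + (r - 1) + i) = G ^ (s + i)] (mod r)"
      unfolding primroot_pow_cong_iff[OF r(3,1)]
      using mod_add_self2[of "s + i" "r - 1"] by (simp add: cong_def add_ac)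
  qed
  have "(\<Oplus>s\<in>{..<m * (r - 1)}. x [^] (G ^ (s + i)))
      = of_Z4 R (int m) \<otimes> (\<Oplus>s\<in>{..<r - 1}. x [^] (G ^ (s + i)))"
    by (rule periodic_sum[of "\<lambda>s. x [^] (G ^ (s + i))", OF _ per]) (use x(1) in simp)
  then show ?thesis unfolding base by (simp add: of_Z4_minus r_minus)
qed

end

text \<open>With \<open>p\<close> and \<open>q\<close> distinct primes, the three power conditions
  say that \<open>\<beta>\<close> has order exactly \<open>p * q\<close>, in the form in which the
  sums over multiples of p and q use it.\<close>

locale cyclotomic_root = cyclotomic_classes p q G H + unit_or_double_ring R
  for p q G H :: nat and R (structure) +
  fixes \<beta>
  assumes root_closed: "\<beta> \<in> carrier R"
    and root_pow: "\<beta> [^] (p * q) = \<one>"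
    and root_pow_p: "\<beta> [^] p \<noteq> \<one>" and root_pow_q: "\<beta> [^] q \<noteq> \<one>"
    and p_mod_8: "[p = 1] (mod 8)" and q_mod_8: "[q = 5] (mod 8)"
begin

abbreviation "E \<equiv> power_sum R"

lemma odd_p: "odd p" and odd_q: "odd q"
proof -
  have "p mod 8 = 1" "q mod 8 = 5" using p_mod_8 q_mod_8 by (simp_all add: cong_def)
  then show "odd p" "odd q" by presburger+
qed

lemma p_prod: "p = 8 * (p div 8) + 1"
  using p_mod_8 mult_div_mod_eq[of 8 p] by (simp add: cong_def)

lemma q_prod: "q = 8 * (q div 8) + 5"
  using q_mod_8 mult_div_mod_eq[of 8 q] by (simp add: cong_def)

lemma sum_over_residues:
  assumes f: "\<And>u. f u \<in> carrier R"
  shows "(\<Oplus>u\<in>{..<p * q}. f u) =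
    ((\<Oplus>u\<in>Qm. f u) \<oplus> (\<Oplus>u\<in>Pm. f u)) \<oplus> (\<Oplus>m\<in>{..<4}. \<Oplus>u\<in>cl m. f u)"
proof -
  have "(\<Oplus>u\<in>{..<p * q}. f u) = (\<Oplus>u\<in>Qm \<union> Pm. f u) \<oplus> (\<Oplus>u\<in>(\<Union>m<4. cl m). f u)"
    unfolding residues_partition using Qm_Pm_class_disjoint f by (intro finsum_Un_disjoint) auto
  also have "(\<Oplus>u\<in>Qm \<union> Pm. f u) = (\<Oplus>u\<in>Qm. f u) \<oplus> (\<Oplus>u\<in>Pm. f u)"
    using Qm_Pm_disjoint f by (intro finsum_Un_disjoint) auto
  also have "(\<Oplus>u\<in>(\<Union>m<4. cl m). f u) = (\<Oplus>m\<in>{..<4}. \<Oplus>u\<in>cl m. f u)"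
    using f class_disjoint by (intro add.finprod_UN_disjoint) (auto simp: pairwise_def disjnt_def)
  finally show ?thesis .
qed

section \<open>Sums over the classes at roots of unity\<close>

lemma power_sum_Qm: "x \<in> carrier R \<Longrightarrow> E Qm x = E {..<p} (x [^] q)"
  unfolding Qm_def by (rule power_sum_image_mult[OF _ q_pos])

lemma power_sum_Pm: "x \<in> carrier R \<Longrightarrow> E Pm x = E {1..<q} (x [^] p)"
  unfolding Pm_def by (rule power_sum_image_mult[OF _ p_pos])

lemma class_power_sum_p:
  assumes x: "x \<in> carrier R" "x [^] p = \<one>" "x \<noteq> \<one>"
  shows "E (cl i) x = of_Z4 R (- int ((q - 1) div 4))"
proof -
  have "E (cl i) x = (\<Oplus>s\<in>{..<e}. x [^] (G ^ s * H ^ i mod (p * q)))"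
    unfolding power_sum_def cl_def using inj_on_class x(1) by (intro finsum_reindex) auto
  also have "\<dots> = (\<Oplus>s\<in>{..<e}. x [^] (G ^ (s + i)))"
  proof (intro finsum_cong' refl pow_cong[OF x(1,2)])
    fix s
    have "[G ^ s * H ^ i mod (p * q) = G ^ s * H ^ i] (mod p)"
      by (simp add: cong_def mod_mod_cancel)
    then show "[G ^ s * H ^ i mod (p * q) = G ^ (s + i)] (mod p)"
      using class_elem_cong_p by (rule cong_trans)
  qed (use x in auto)
  also have "\<dots> = of_Z4 R (- int ((q - 1) div 4))"
    unfolding e_eq_mult_p by (rule primroot_power_sum[OF prime_p odd_p primroot_p x])
  finally show ?thesis .
qed

lemma class_power_sum_q:
  assumes x: "x \<in> carrier R" "x [^] q = \<one>" "x \<noteq> \<one>"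
  shows "E (cl i) x = of_Z4 R (- int ((p - 1) div 4))"
proof -
  have "E (cl i) x = (\<Oplus>s\<in>{..<e}. x [^] (G ^ s * H ^ i mod (p * q)))"
    unfolding power_sum_def cl_def using inj_on_class x(1) by (intro finsum_reindex) auto
  \<comment> \<open>Modulo q the class index drops out, so all classes give the same exponents; the
    zero shift only fits the pattern of \<open>primroot_power_sum\<close>.\<close>
  also have "\<dots> = (\<Oplus>s\<in>{..<e}. x [^] (G ^ (s + 0)))"
  proof (intro finsum_cong' refl pow_cong[OF x(1,2)])
    fix s
    have "[G ^ s * H ^ i mod (p * q) = G ^ s * H ^ i] (mod q)"
      by (simp add: cong_def mod_mod_cancel)
    then show "[G ^ s * H ^ i mod (p * q) = G ^ (s + 0)] (mod q)"
      using class_elem_cong_q[of s i] unfolding add_0_right by (rule cong_trans)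
  qed (use x in auto)
  also have "\<dots> = of_Z4 R (- int ((p - 1) div 4))"
    unfolding e_eq_mult_q by (rule primroot_power_sum[OF prime_q odd_q primroot_q x])
  finally show ?thesis .
qed

text \<open>The sum of all powers of \<open>\<beta>\<close> vanishes. The multiples of q, with 0
  among them, form a full sum of p-th roots of unity and give 0; the multiples of p lack 0 and give
  -1; the classes must balance this with 1.\<close>

lemma class_power_sum_total: "(\<Oplus>m\<in>{..<4}. E (cl m) \<beta>) = \<one>"
proof -
  have "\<beta> \<noteq> \<one>" using root_pow_p by auto
  then have "\<zero> = E {..<p * q} \<beta>"
    using root_of_unity_sum[OF root_closed root_pow] odd_p odd_q by simp
  also have "\<dots> = (E Qm \<beta> \<oplus> E Pm \<beta>) \<oplus> (\<Oplus>m\<in>{..<4}. E (cl m) \<beta>)"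
    unfolding power_sum_def using root_closed by (intro sum_over_residues) simp
  also have "E Qm \<beta> = \<zero>"
    unfolding power_sum_Qm[OF root_closed]
    using root_closed root_pow root_pow_q odd_p
    by (intro root_of_unity_sum) (simp_all add: nat_pow_pow mult.commute)
  also have "E Pm \<beta> = \<ominus> \<one>"
    unfolding power_sum_Pm[OF root_closed]
    using root_closed root_pow root_pow_p odd_q
    by (intro root_of_unity_sum_nonzero) (simp_all add: nat_pow_pow)
  finally have "\<zero> = \<ominus> \<one> \<oplus> (\<Oplus>m\<in>{..<4}. E (cl m) \<beta>)" using root_closed by simp
  moreover have "(\<Oplus>m\<in>{..<4}. E (cl m) \<beta>) \<in> carrier R" using root_closed by auto
  ultimately show ?thesis by (metis one_closed a_inv_closed minus_equality minus_minus a_comm)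
qed

text \<open>The summand for m = 0 is zero; it is kept so that the sum ranges over all four classes
  and can be rotated.\<close>

definition \<rho> where "\<rho> = (\<Oplus>m\<in>{..<4}. of_Z4 R (int m) \<otimes> E (cl m) \<beta>)"

text \<open>The Mattson-Solomon coefficient of index n as a function of x = \<beta>^(-n). The set
  \<open>Pm\<close> is absent because the sequence vanishes there.\<close>

definition ms_value where
  "ms_value x = (of_Z4 R 2 \<otimes> E Qm x) \<oplus> (\<Oplus>m\<in>{..<4}. of_Z4 R (int m) \<otimes> E (cl m) x)"

lemma ms_sum_eq_ms_value:
  assumes x: "x \<in> carrier R" and Q: "\<And>u. u \<in> Qm \<Longrightarrow> a u = 2" and P: "\<And>u. u \<in> Pm \<Longrightarrow> a u = 0"
    and C: "\<And>m u. m < 4 \<Longrightarrow> u \<in> cl m \<Longrightarrow> a u = int m"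
  shows "(\<Oplus>u\<in>{..<p * q}. of_Z4 R (a u) \<otimes> x [^] u) = ms_value x"
proof -
  have "(\<Oplus>u\<in>Qm. of_Z4 R (a u) \<otimes> x [^] u) = (\<Oplus>u\<in>Qm. of_Z4 R 2 \<otimes> x [^] u)"
    using Q x by (intro finsum_cong') auto
  also have "\<dots> = of_Z4 R 2 \<otimes> E Qm x"
    unfolding power_sum_def using x by (intro finsum_rdistr[symmetric]) auto
  finally have Qs: "(\<Oplus>u\<in>Qm. of_Z4 R (a u) \<otimes> x [^] u) = of_Z4 R 2 \<otimes> E Qm x" .
  have "(\<Oplus>u\<in>Pm. of_Z4 R (a u) \<otimes> x [^] u) = (\<Oplus>u\<in>Pm. \<zero>)"
    using P x by (intro finsum_cong') auto
  then have Ps: "(\<Oplus>u\<in>Pm. of_Z4 R (a u) \<otimes> x [^] u) = \<zero>" by simp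
  have Cs: "(\<Oplus>u\<in>cl m. of_Z4 R (a u) \<otimes> x [^] u) = of_Z4 R (int m) \<otimes> E (cl m) x" if "m < 4" for m
  proof -
    have "(\<Oplus>u\<in>cl m. of_Z4 R (a u) \<otimes> x [^] u) = (\<Oplus>u\<in>cl m. of_Z4 R (int m) \<otimes> x [^] u)"
      using C[OF that] x by (intro finsum_cong') auto
    also have "\<dots> = of_Z4 R (int m) \<otimes> E (cl m) x"
      unfolding power_sum_def using x by (intro finsum_rdistr[symmetric]) auto
    finally show ?thesis .
  qed
  have "(\<Oplus>m\<in>{..<4}. \<Oplus>u\<in>cl m. of_Z4 R (a u) \<otimes> x [^] u)
      = (\<Oplus>m\<in>{..<4}. of_Z4 R (int m) \<otimes> E (cl m) x)"
    using Cs x by (intro finsum_cong') auto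
  with Qs Ps show ?thesis
    using x by (subst sum_over_residues) (auto simp: ms_value_def)
qed

text \<open>The factor 6 is 0 + 1 + 2 + 3.\<close>

lemma sum_of_Z4_const:
  assumes "\<And>m. m < 4 \<Longrightarrow> y m = of_Z4 R c"
  shows "(\<Oplus>m\<in>{..<4::nat}. of_Z4 R (int m) \<otimes> y m) = of_Z4 R (6 * c)"
proof -
  have "(\<Oplus>m\<in>{..<4::nat}. of_Z4 R (int m) \<otimes> y m) = (\<Oplus>m\<in>{..<4::nat}. of_Z4 R (int m * c))"
    using assms by (intro finsum_cong') (auto simp: of_Z4_mult)
  also have "\<dots> = of_Z4 R (6 * c)"
    by (simp add: numeral_eq_Suc lessThan_Suc of_Z4_add[symmetric] algebra_simps)
  finally show ?thesis .
qed

text \<open>At 1 the sums count exponents, giving 2p + 6e. Here p is odd, so 2p = 2 modulo 4, and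
  \<open>e\<close> is a multiple of p - 1, hence of 8.\<close>

lemma ms_value_one: "ms_value \<one> = of_Z4 R 2"
proof -
  have "card Qm = p" unfolding Qm_def using q_pos by (subst card_image) (auto simp: inj_on_def)
  then have "ms_value \<one> = of_Z4 R (2 * int p + 6 * int e)"
    unfolding ms_value_def using sum_of_Z4_const[of "\<lambda>m. E (cl m) \<one>" "int e"]
    by (simp add: power_sum_one card_class of_Z4_add of_Z4_mult)
  also have "\<dots> = of_Z4 R 2"
  proof (rule of_Z4_cong)
    have "e = 4 * ((q - 1) div 4 * (2 * (p div 8)))" unfolding e_eq_mult_p using arg_cong[OF p_prod, of "\<lambda>k. k - 1"] by simp
    then have eq: "2 * int p + 6 * int e = 2 + 4 * (4 * int (p div 8) + 6 * (int ((q - 1) div 4) * (2 * int (p div 8))))"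
      using arg_cong[OF p_prod, of int] by simp
    show "[2 * int p + 6 * int e = 2] (mod 4)" unfolding eq cong_def by (rule mod_mult_self2)
  qed
  finally show ?thesis .
qed

text \<open>Only the classes contribute, because \<open>x [^] q\<close> is again a nontrivial p-th
  root of unity. The result is -6(q-1)/4, and (q-1)/4 is odd by q = 5 modulo 8, leaving -6 = 2
  modulo 4.\<close>

lemma ms_value_order_p:
  assumes x: "x \<in> carrier R" "x [^] p = \<one>" "x \<noteq> \<one>"
  shows "ms_value x = of_Z4 R 2"
proof -
  have "x [^] q \<noteq> \<one>"
    using pow_neq_one[OF x] coprime_p_q by (simp add: coprime_commute)
  moreover have "(x [^] q) [^] p = \<one>"
    using x nat_pow_pow[OF x(1), of p q] nat_pow_pow[OF x(1), of q p] by (simp add: mult.commute)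
  ultimately have "E Qm x = \<zero>"
    unfolding power_sum_Qm[OF x(1)] using x(1) odd_p by (intro root_of_unity_sum) simp_all
  then have "ms_value x = of_Z4 R (6 * - int ((q - 1) div 4))"
    unfolding ms_value_def using sum_of_Z4_const[of "\<lambda>m. E (cl m) x"] class_power_sum_p[OF x] by simp
  also have "\<dots> = of_Z4 R 2"
  proof (rule of_Z4_cong)
    have "(q - 1) div 4 = 2 * (q div 8) + 1" using q_prod by presburger
    then have "6 * - int ((q - 1) div 4) = 2 + 4 * (- 3 * int (q div 8) - 2)" by simp
    then show "[6 * - int ((q - 1) div 4) = 2] (mod 4)" unfolding cong_def by presburger
  qed
  finally show ?thesis .
qed

text \<open>Now \<open>x [^] q\<close> is 1, so the multiples of q contribute 2p = 2 modulo 4. The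
  classes contribute -6(p-1)/4, which vanishes modulo 4 since (p-1)/4 is even.\<close>

lemma ms_value_order_q:
  assumes x: "x \<in> carrier R" "x [^] q = \<one>" "x \<noteq> \<one>"
  shows "ms_value x = of_Z4 R 2"
proof -
  have "E Qm x = of_Z4 R (int p)"
    unfolding power_sum_Qm[OF x(1)] x(2) by (simp add: power_sum_one)
  then have "ms_value x = of_Z4 R (2 * int p + 6 * - int ((p - 1) div 4))"
    unfolding ms_value_def using sum_of_Z4_const[of "\<lambda>m. E (cl m) x"] class_power_sum_q[OF x]
    by (simp add: of_Z4_add of_Z4_mult del: minus_mult_minus mult_minus_right)
  also have "\<dots> = of_Z4 R 2"
  proof (rule of_Z4_cong)
    have "(p - 1) div 4 = 2 * (p div 8)" using p_prod by presburger
    then have "2 * int p + 6 * - int ((p - 1) div 4) = 2 + 4 * int (p div 8)"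
      using arg_cong[OF p_prod, of int] by simp
    then show "[2 * int p + 6 * - int ((p - 1) div 4) = 2] (mod 4)" by (simp add: cong_def)
  qed
  finally show ?thesis .
qed

lemma class_power_sum_shift:
  assumes "n \<in> cl k"
  shows "E (cl m) (\<beta> [^] n) = E (cl ((k + m) mod 4)) \<beta>"
proof (rule power_sum_bij[OF class_mult_bij[OF assms] root_closed])
  fix u
  have "\<beta> [^] (n * u mod (p * q)) = \<beta> [^] (n * u)"
    by (rule pow_cong[OF root_closed root_pow]) (simp add: cong_def)
  then show "\<beta> [^] (n * u mod (p * q)) = (\<beta> [^] n) [^] u"
    using root_closed by (simp add: nat_pow_pow)
qed

lemma ms_value_class:
  assumes n: "n \<in> cl ((2 + k) mod 4)"
  shows "ms_value (\<beta> [^] n) = \<rho> \<oplus> of_Z4 R (2 - int k)"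
proof -
  let ?\<sigma> = "\<lambda>m. ((2 + k) mod 4 + m) mod 4"
  have n_tot: "\<not> p dvd n" "\<not> q dvd n"
    using n class_subset totatives_pq_iff by blast+
  have "E Qm (\<beta> [^] n) = \<zero>"
  proof -
    have "\<beta> [^] q \<in> carrier R" "(\<beta> [^] q) [^] p = \<one>"
      using root_closed root_pow by (simp_all add: nat_pow_pow mult.commute)
    moreover have "coprime n p" using prime_imp_coprime[OF prime_p n_tot(1)] by (simp add: coprime_commute)
    ultimately have "(\<beta> [^] q) [^] n \<noteq> \<one>" "((\<beta> [^] q) [^] n) [^] p = \<one>"
      using pow_neq_one[of "\<beta> [^] q" p n] root_pow_q
      by (simp_all add: nat_pow_pow) (metis nat_pow_pow nat_pow_one mult.commute)
    moreover have "(\<beta> [^] n) [^] q = (\<beta> [^] q) [^] n"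
      using root_closed by (simp add: nat_pow_pow mult.commute)
    ultimately show ?thesis
      using root_closed odd_p by (subst power_sum_Qm) (auto intro!: root_of_unity_sum)
  qed
  then have "ms_value (\<beta> [^] n) = (\<Oplus>m\<in>{..<4}. of_Z4 R (int m) \<otimes> E (cl m) (\<beta> [^] n))"
    unfolding ms_value_def using root_closed by (simp add: Pi_def)
  \<comment> \<open>Solving \<open>?\<sigma> m\<close> = m + k + 2 for m modulo 4 expresses the
    weight through the new class index, so that the sum can be reindexed.\<close>
  also have "\<dots> = (\<Oplus>m\<in>{..<4}. of_Z4 R (int (?\<sigma> m) + (- 2 - int k)) \<otimes> E (cl (?\<sigma> m)) \<beta>)"
  proof (intro finsum_cong' refl)
    fix m :: nat
    have "[int m = int (?\<sigma> m) + (- 2 - int k)] (mod 4)"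
      by (simp add: cong_def zmod_int mod_simps)
    then show "of_Z4 R (int m) \<otimes> E (cl m) (\<beta> [^] n)
        = of_Z4 R (int (?\<sigma> m) + (- 2 - int k)) \<otimes> E (cl (?\<sigma> m)) \<beta>"
      using of_Z4_cong class_power_sum_shift[OF n] by metis
  qed (use root_closed in auto)
  also have "\<dots> = (\<Oplus>i\<in>?\<sigma> ` {..<4}. of_Z4 R (int i + (- 2 - int k)) \<otimes> E (cl i) \<beta>)"
  proof (rule finsum_reindex[symmetric])
    show "inj_on ?\<sigma> {..<4}"
      by (rule inj_onI) (metis cong_def cong_add_lcancel_nat cong_less_modulus_unique_nat lessThan_iff)
  qed (use root_closed in auto)
  also have "?\<sigma> ` {..<4} = {..<4}"
    by (rule endo_inj_surj)
       (auto intro!: inj_onI, metis cong_def cong_add_lcancel_nat cong_less_modulus_unique_nat lessThan_iff)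
  also have "(\<Oplus>i\<in>{..<4}. of_Z4 R (int i + (- 2 - int k)) \<otimes> E (cl i) \<beta>)
      = (\<Oplus>i\<in>{..<4}. of_Z4 R (int i) \<otimes> E (cl i) \<beta> \<oplus> of_Z4 R (- 2 - int k) \<otimes> E (cl i) \<beta>)"
    using root_closed by (intro finsum_cong') (auto simp: of_Z4_add[of "int _"] l_distr)
  also have "\<dots> = \<rho> \<oplus> (\<Oplus>i\<in>{..<4}. of_Z4 R (- 2 - int k) \<otimes> E (cl i) \<beta>)"
    unfolding \<rho>_def using root_closed by (intro finsum_addf) auto
  also have "(\<Oplus>i\<in>{..<4}. of_Z4 R (- 2 - int k) \<otimes> E (cl i) \<beta>)
      = of_Z4 R (- 2 - int k) \<otimes> (\<Oplus>i\<in>{..<4}. E (cl i) \<beta>)"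
    using root_closed by (intro finsum_rdistr[symmetric]) auto
  also have "\<dots> = of_Z4 R (2 - int k)"
    unfolding class_power_sum_total
    by (simp add: of_Z4_cong[of "- 2 - int k" "2 - int k"] cong_iff_dvd_diff)
  finally show ?thesis .
qed

end

section \<open>The Mattson-Solomon polynomial\<close>

context cyclotomic_root
begin

text \<open>Replacing -1 by the residue \<open>p * q - 1\<close> makes all exponents natural, so the
  results on classes of naturals apply to inverse powers of \<open>\<beta>\<close>.\<close>

lemma inv_root_int_pow: "\<beta> [^] (- int m) = \<beta> [^] ((p * q - 1) * m)"
proof -
  obtain k where k: "p * q = Suc k" using pq_gt_1 by (metis not0_implies_Suc not_one_less_zero)
  have "\<beta> [^] m \<otimes> \<beta> [^] ((p * q - 1) * m) = \<beta> [^] (p * q * m)"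
    using root_closed unfolding k by (simp add: nat_pow_mult)
  also have "\<dots> = \<one>"
    using root_closed root_pow by (simp add: nat_pow_pow[symmetric])
  finally have "inv (\<beta> [^] m) = \<beta> [^] ((p * q - 1) * m)"
    using root_closed by (intro comm_inv_char) simp_all
  then show ?thesis using root_closed by (cases "m = 0") (simp_all add: int_pow_def2)
qed

lemma ms_coeff_eq_ms_value:
  assumes "\<And>u. u \<in> Qm \<Longrightarrow> a u = 2" "\<And>u. u \<in> Pm \<Longrightarrow> a u = 0"
    and "\<And>m u. m < 4 \<Longrightarrow> u \<in> cl m \<Longrightarrow> a u = int m"
  shows "ms_coeff R (p * q) a \<beta> n = ms_value (\<beta> [^] ((p * q - 1) * n))"
proof -
  have "\<beta> [^] (- int (n * u)) = (\<beta> [^] ((p * q - 1) * n)) [^] u" for u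
    unfolding inv_root_int_pow using root_closed by (simp add: nat_pow_pow mult.assoc)
  then show ?thesis
    unfolding ms_coeff_def
    using ms_sum_eq_ms_value[of "\<beta> [^] ((p * q - 1) * n)" a] assms root_closed by simp
qed

lemma coprime_pq_minus_1: "coprime (p * q - 1) (p * q)"
  using minus_one_in_totatives[of "p * q"] pq_gt_1 by (simp add: in_totatives_iff)

lemma ms_value_multiple:
  assumes "n \<in> Qm \<union> Pm"
  shows "ms_value (\<beta> [^] ((p * q - 1) * n)) = of_Z4 R 2"
proof (cases "n = 0")
  case True
  then show ?thesis by (simp add: ms_value_one)
next
  case False
  \<comment> \<open>With n = j k and k r = p q, the element \<open>\<beta> [^] k\<close> is a
    nontrivial r-th root of unity. The remaining exponent \<open>(p * q - 1) * j\<close> is coprime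
    to \<open>r\<close>, so the power stays nontrivial.\<close>
  have aux: "(\<beta> [^] ((p * q - 1) * n)) [^] r = \<one> \<and> \<beta> [^] ((p * q - 1) * n) \<noteq> \<one>"
    if r: "Factorial_Ring.prime r" and n: "n = j * k" and j: "0 < j" "j < r" and kr: "k * r = p * q"
      and k: "\<beta> [^] k \<noteq> \<one>" for r j k
  proof -
    have "coprime j r" using r j by (metis coprime_commute nat_dvd_not_less prime_imp_coprime)
    moreover have "coprime (p * q - 1) r" using coprime_pq_minus_1 unfolding kr[symmetric] by simp
    ultimately have "coprime ((p * q - 1) * j) r" by simp
    moreover have "\<beta> [^] ((p * q - 1) * n) = (\<beta> [^] k) [^] ((p * q - 1) * j)"
      using root_closed by (simp add: nat_pow_pow n mult_ac)
    moreover have "(\<beta> [^] k) [^] r = \<one>" using root_closed root_pow by (simp add: nat_pow_pow kr)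
    moreover have "((\<beta> [^] k) [^] ((p * q - 1) * j)) [^] r = ((\<beta> [^] k) [^] r) [^] ((p * q - 1) * j)"
      using root_closed by (simp add: nat_pow_pow mult_ac)
    ultimately show ?thesis
      using pow_neq_one[of "\<beta> [^] k" r "(p * q - 1) * j"] root_closed k by simp
  qed
  have closed: "\<beta> [^] ((p * q - 1) * n) \<in> carrier R" using root_closed by simp
  from assms show ?thesis
  proof
    assume "n \<in> Qm"
    then obtain j where "j < p" "n = j * q" by (auto simp: Qm_def)
    then show ?thesis
      using False aux[OF prime_p, of j q] root_pow_q ms_value_order_p[OF closed] by (simp add: mult.commute)
  next
    assume "n \<in> Pm"
    then obtain j where "j < q" "n = j * p" by (auto simp: Pm_def)
    then show ?thesis
      using False aux[OF prime_q, of j p] root_pow_p ms_value_order_q[OF closed] by simp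
  qed
qed

lemma ms_value_class_index:
  assumes "n \<in> cl k"
  shows "ms_value (\<beta> [^] ((p * q - 1) * n)) = \<rho> \<oplus> of_Z4 R (2 - int k)"
proof -
  have "\<beta> [^] ((p * q - 1) * n) = \<beta> [^] ((p * q - 1) * n mod (p * q))"
    by (rule pow_cong[OF root_closed root_pow]) (simp add: cong_def)
  moreover have "(p * q - 1) * n mod (p * q) \<in> cl ((2 + k) mod 4)"
    using class_mult[OF minus_one_class[OF p_mod_8 q_mod_8] assms] .
  ultimately show ?thesis using ms_value_class by simp
qed

end

section \<open>From values at roots of unity to formal polynomials\<close>

lemma (in UP_ring) finsum_monom_apply:
  assumes "finite A" "\<And>u. u \<in> A \<Longrightarrow> c u \<in> carrier R"
  shows "up_ring.coeff P (\<Oplus>\<^bsub>P\<^esub>u\<in>A. up_ring.monom P (c u) u) n = (if n \<in> A then c n else \<zero>)"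
proof -
  have "up_ring.coeff P (\<Oplus>\<^bsub>P\<^esub>u\<in>A. up_ring.monom P (c u) u) n = (\<Oplus>u\<in>A. if n = u then c u else \<zero>)"
    using assms by (subst coeff_finsum) (auto intro!: R.finsum_cong')
  also have "\<dots> = (if n \<in> A then c n else \<zero>)"
  proof (cases "n \<in> A")
    case True
    then show ?thesis using R.finsum_singleton[OF True assms(1), of c] assms(2) by simp
  next
    case False
    then have "(\<Oplus>u\<in>A. if n = u then c u else \<zero>) = (\<Oplus>u\<in>A. \<zero>)"
      by (intro R.finsum_cong') auto
    then show ?thesis using False by simp
  qed
  finally show ?thesis .
qed

lemma (in UP_ring) coeff_eq_apply: "p \<in> carrier P \<Longrightarrow> up_ring.coeff P p n = p n"
  unfolding P_def by (simp add: UP_def)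

lemma (in UP_ring) finsum_monom_image:
  assumes "inj_on \<phi> A" "c \<in> carrier R"
  shows "(\<Oplus>\<^bsub>P\<^esub>u\<in>\<phi> ` A. up_ring.monom P c u) = (\<Oplus>\<^bsub>P\<^esub>j\<in>A. up_ring.monom P c (\<phi> j))"
  using assms by (intro P.finsum_reindex) auto

lemma cyc_poly_closed: "cyc_poly p q g h i \<in> carrier (UP Z4)"
proof -
  interpret U: UP_cring Z4 "UP Z4" using cring_Z4 by (simp add: UP_cring_def)
  show ?thesis unfolding cyc_poly_def by (intro U.P.finsum_closed) simp
qed

lemma cyc_poly_apply:
  assumes "finite (cyc_class p q g h i)"
  shows "cyc_poly p q g h i n = (if n \<in> cyc_class p q g h i then 1 else 0)"
proof -
  interpret U: UP_cring Z4 "UP Z4" using cring_Z4 by (simp add: UP_cring_def)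
  have "cyc_poly p q g h i n = up_ring.coeff (UP Z4) (cyc_poly p q g h i) n"
    using U.coeff_eq_apply[OF cyc_poly_closed] by simp
  also have "\<dots> = (if n \<in> cyc_class p q g h i then \<one>\<^bsub>Z4\<^esub> else \<zero>\<^bsub>Z4\<^esub>)"
    unfolding cyc_poly_def using assms by (intro U.finsum_monom_apply) auto
  finally show ?thesis by (simp add: residue_ring_def)
qed

text \<open>Compatibility with reduction modulo 4 comes from 4 = 0 in the ring; formal evaluation of
  polynomials over \<open>Z4\<close> requires this homomorphism.\<close>

lemma (in unit_or_double_ring) of_Z4_ring_hom: "of_Z4 R \<in> ring_hom Z4 R"
proof (rule ring_hom_memI)
  fix c d
  show "of_Z4 R (c \<otimes>\<^bsub>Z4\<^esub> d) = of_Z4 R c \<otimes> of_Z4 R d"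
    unfolding of_Z4_mult[symmetric] by (rule of_Z4_cong) (simp add: residue_ring_def cong_def)
  show "of_Z4 R (c \<oplus>\<^bsub>Z4\<^esub> d) = of_Z4 R c \<oplus> of_Z4 R d"
    unfolding of_Z4_add[symmetric] by (rule of_Z4_cong) (simp add: residue_ring_def cong_def)
qed (simp_all add: residue_ring_def)

lemma (in unit_or_double_ring) eval_cyc_poly:
  assumes "finite (cyc_class p q g h i)" "x \<in> carrier R"
  shows "UnivPoly.eval Z4 R (of_Z4 R) x (cyc_poly p q g h i) = power_sum R (cyc_class p q g h i) x"
proof -
  interpret h: ring_hom_cring Z4 R "of_Z4 R"
    using cring_Z4 is_cring of_Z4_ring_hom by (rule ring_hom_cringI)
  interpret U: UP_pre_univ_prop Z4 R "of_Z4 R" "UP Z4"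
    by (intro UP_pre_univ_prop.intro UP_cring.intro h.ring_hom_cring_axioms cring_Z4) simp
  interpret ev: ring_hom_cring "UP Z4" R "UnivPoly.eval Z4 R (of_Z4 R) x"
    using U.UP_cring is_cring U.eval_ring_hom[OF assms(2)] by (intro ring_hom_cringI) simp_all
  have "UnivPoly.eval Z4 R (of_Z4 R) x (cyc_poly p q g h i)
      = (\<Oplus>u\<in>cyc_class p q g h i. UnivPoly.eval Z4 R (of_Z4 R) x (up_ring.monom (UP Z4) \<one>\<^bsub>Z4\<^esub> u))"
    unfolding cyc_poly_def by (subst ev.hom_finsum) (simp_all add: comp_def)
  also have "\<dots> = power_sum R (cyc_class p q g h i) x"
    unfolding power_sum_def using assms(2) U.eval_monom[of "\<one>\<^bsub>Z4\<^esub>" x]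
    by (intro finsum_cong') auto
  finally show ?thesis .
qed

text \<open>The bridge from the integers \<open>g\<close>, \<open>h\<close> of the definition to the
  natural generators with which the classes are studied.\<close>

lemma cyc_class_eq_nat:
  assumes "p * q > 0"
  shows "cyc_class p q g h i =
    (\<lambda>s. nat (g mod int (p * q)) ^ s * nat (h mod int (p * q)) ^ i mod (p * q)) ` {..<(p - 1) * (q - 1) div 4}"
proof -
  let ?G = "nat (g mod int (p * q))" and ?H = "nat (h mod int (p * q))"
  have "int (?G ^ s * ?H ^ i mod (p * q)) = (g ^ s * h ^ i) mod int (p * q)" for s
  proof -
    have "int ?G = g mod int (p * q)" "int ?H = h mod int (p * q)" using assms by simp_all
    then have "int (?G ^ s * ?H ^ i mod (p * q))
        = ((g mod int (p * q)) ^ s * (h mod int (p * q)) ^ i) mod int (p * q)"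
      by (simp only: zmod_int of_nat_mult of_nat_power)
    also have "\<dots> = (g ^ s * h ^ i) mod int (p * q)"
      by (intro cong_mult[unfolded cong_def] cong_pow[unfolded cong_def] mod_mod_trivial)
    finally show ?thesis .
  qed
  then have "nat ((g ^ s * h ^ i) mod int (p * q)) = ?G ^ s * ?H ^ i mod (p * q)" for s
    by (metis nat_int)
  then show ?thesis unfolding cyc_class_def by (auto simp: image_def)
qed

text \<open>All exponents on both sides lie below \<open>p * q\<close>, so the polynomials can be
  compared coefficient by coefficient. The partition of the residues decides which of the three
  summands contributes. Sequence and class polynomials enter only through their values, which
  separates this comparison from their definitions.\<close>

lemma (in cyclotomic_root) mattson_solomon_eq:
  assumes a: "\<And>u. u \<in> Qm \<Longrightarrow> a u = 2" "\<And>u. u \<in> Pm \<Longrightarrow> a u = 0"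
      "\<And>m u. m < 4 \<Longrightarrow> u \<in> cl m \<Longrightarrow> a u = int m"
    and D: "\<And>k n. k < 4 \<Longrightarrow> D k n = (if n \<in> cl k then 1 else 0)"
  shows "mattson_solomon R (p * q) a \<beta> =
          [(2::nat)] \<cdot>\<^bsub>UP R\<^esub> (\<Oplus>\<^bsub>UP R\<^esub> j \<in> {0..p - 1}. up_ring.monom (UP R) \<one> (j * q))
          \<oplus>\<^bsub>UP R\<^esub> [(2::nat)] \<cdot>\<^bsub>UP R\<^esub> (\<Oplus>\<^bsub>UP R\<^esub> j \<in> {1..q - 1}. up_ring.monom (UP R) \<one> (j * p))
          \<oplus>\<^bsub>UP R\<^esub> (\<Oplus>\<^bsub>UP R\<^esub> k \<in> {0..3::nat}.
                 (\<rho> \<oplus> of_Z4 R (2 - int k)) \<odot>\<^bsub>UP R\<^esub> poly_of_Z4 R (D k))"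
    (is "?L = [(2::nat)] \<cdot>\<^bsub>UP R\<^esub> ?X \<oplus>\<^bsub>UP R\<^esub> [(2::nat)] \<cdot>\<^bsub>UP R\<^esub> ?Y \<oplus>\<^bsub>UP R\<^esub> ?Z")
proof -
  interpret U: UP_cring R "UP R" using is_cring by (simp add: UP_cring_def)
  let ?c = "ms_coeff R (p * q) a \<beta>"
  have c: "?c n = ms_value (\<beta> [^] ((p * q - 1) * n))" for n
    by (rule ms_coeff_eq_ms_value[OF a])
  have \<rho>: "\<rho> \<in> carrier R"
    unfolding \<rho>_def using root_closed by (intro finsum_closed) auto
  have ms_closed: "ms_value (\<beta> [^] (m::nat)) \<in> carrier R" for m
    unfolding ms_value_def using root_closed by (intro a_closed finsum_closed) auto
  have X: "?X = (\<Oplus>\<^bsub>UP R\<^esub>u\<in>Qm. up_ring.monom (UP R) \<one> u)"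
  proof -
    have "{0..p - 1} = {..<p}" using p_pos by auto
    moreover have "inj_on (\<lambda>j. j * q) {..<p}" using q_pos by (simp add: inj_on_def)
    ultimately show ?thesis
      unfolding Qm_def using U.finsum_monom_image[of "\<lambda>j. j * q" "{..<p}" \<one>] by simp
  qed
  have Y: "?Y = (\<Oplus>\<^bsub>UP R\<^esub>u\<in>Pm. up_ring.monom (UP R) \<one> u)"
  proof -
    have "{1..q - 1} = {1..<q}" using q_pos by auto
    moreover have "inj_on (\<lambda>j. j * p) {1..<q}" using p_pos by (simp add: inj_on_def)
    ultimately show ?thesis
      unfolding Pm_def using U.finsum_monom_image[of "\<lambda>j. j * p" "{1..<q}" \<one>] by simp
  qed
  have XY: "?X \<in> carrier (UP R)" "?Y \<in> carrier (UP R)"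
    by (intro U.P.finsum_closed; simp)+
  have D_closed: "poly_of_Z4 R (D k) \<in> carrier (UP R)"
    and D_coeff: "up_ring.coeff (UP R) (poly_of_Z4 R (D k)) n = (if n \<in> cl k then \<one> else \<zero>)"
    if "k < 4" for k n
  proof -
    have "cl k \<subseteq> {..<p * q}" using class_subset totatives_pq_iff by blast
    then have "bound \<zero> (p * q) (poly_of_Z4 R (D k))"
      using D[OF that] by (auto simp: bound_def poly_of_Z4_def)
    then show *: "poly_of_Z4 R (D k) \<in> carrier (UP R)"
      by (auto simp: UP_def poly_of_Z4_def intro!: mem_upI)
    show "up_ring.coeff (UP R) (poly_of_Z4 R (D k)) n = (if n \<in> cl k then \<one> else \<zero>)"
      using U.coeff_eq_apply[OF *] D[OF that] by (simp add: poly_of_Z4_def)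
  qed
  have Z_closed: "(\<lambda>k. (\<rho> \<oplus> of_Z4 R (2 - int k)) \<odot>\<^bsub>UP R\<^esub> poly_of_Z4 R (D k)) \<in> {0..3} \<rightarrow> carrier (UP R)"
    using \<rho> D_closed by auto
  then have Z: "?Z \<in> carrier (UP R)" by (rule U.P.finsum_closed)
  have double: "up_ring.coeff (UP R) ([(2::nat)] \<cdot>\<^bsub>UP R\<^esub> (\<Oplus>\<^bsub>UP R\<^esub>u\<in>A. up_ring.monom (UP R) \<one> u)) n
      = (if n \<in> A then of_Z4 R 2 else \<zero>)" if "finite A" for A n
  proof -
    let ?M = "\<Oplus>\<^bsub>UP R\<^esub>u\<in>A. up_ring.monom (UP R) \<one> u"
    have M: "?M \<in> carrier (UP R)" by (intro U.P.finsum_closed) simp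
    have "[(2::nat)] \<cdot>\<^bsub>UP R\<^esub> ?M = ?M \<oplus>\<^bsub>UP R\<^esub> ?M"
      using M by (simp add: add_pow_def numeral_2_eq_2)
    then have "up_ring.coeff (UP R) ([(2::nat)] \<cdot>\<^bsub>UP R\<^esub> ?M) n = up_ring.coeff (UP R) ?M n \<oplus> up_ring.coeff (UP R) ?M n"
      using M by simp
    then show ?thesis
      using U.finsum_monom_apply[OF that, of "\<lambda>_. \<one>" n] of_Z4_add[of 1 1] by simp
  qed
  have Z_coeff: "up_ring.coeff (UP R) ?Z n
      = (\<Oplus>k\<in>{0..3}. if n \<in> cl k then \<rho> \<oplus> of_Z4 R (2 - int k) else \<zero>)" for n
  proof -
    have "up_ring.coeff (UP R) ?Z n
        = (\<Oplus>k\<in>{0..3}. up_ring.coeff (UP R) ((\<rho> \<oplus> of_Z4 R (2 - int k)) \<odot>\<^bsub>UP R\<^esub> poly_of_Z4 R (D k)) n)"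
      using Z_closed by (intro U.coeff_finsum) simp_all
    also have "\<dots> = (\<Oplus>k\<in>{0..3}. if n \<in> cl k then \<rho> \<oplus> of_Z4 R (2 - int k) else \<zero>)"
      using \<rho> D_closed D_coeff by (intro finsum_cong') auto
    finally show ?thesis .
  qed
  have Z_zero: "up_ring.coeff (UP R) ?Z n = \<zero>" if "n \<notin> (\<Union>m<4. cl m)" for n
  proof -
    have "(\<Oplus>k\<in>{0..3}. if n \<in> cl k then \<rho> \<oplus> of_Z4 R (2 - int k) else \<zero>) = (\<Oplus>k\<in>{0..3::nat}. \<zero>)"
      using that by (intro finsum_cong') auto
    then show ?thesis unfolding Z_coeff by simp
  qed
  have Z_class: "up_ring.coeff (UP R) ?Z n = \<rho> \<oplus> of_Z4 R (2 - int m)" if m: "m < 4" "n \<in> cl m" for n m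
  proof -
    have uniq: "n \<in> cl k \<longleftrightarrow> m = k" if "k \<in> {0..3}" for k
      using class_disjoint[of m k] that m by auto
    have "(\<Oplus>k\<in>{0..3}. if n \<in> cl k then \<rho> \<oplus> of_Z4 R (2 - int k) else \<zero>)
        = (\<Oplus>k\<in>{0..3}. if m = k then \<rho> \<oplus> of_Z4 R (2 - int k) else \<zero>)"
      using uniq \<rho> by (intro finsum_cong') auto
    also have "\<dots> = \<rho> \<oplus> of_Z4 R (2 - int m)"
      using m(1) \<rho> by (intro finsum_singleton) auto
    finally show ?thesis unfolding Z_coeff .
  qed
  have L: "?L \<in> carrier (UP R)"
    unfolding mattson_solomon_def using c ms_closed by (intro U.P.finsum_closed) simp
  show ?thesis
  proof (rule U.up_eqI)
    fix n
    have L_coeff: "up_ring.coeff (UP R) ?L n = (if n < p * q then ?c n else \<zero>)"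
      unfolding mattson_solomon_def using U.finsum_monom_apply[of "{..<p * q}" ?c n] c ms_closed by simp
    have sum: "up_ring.coeff (UP R) ([(2::nat)] \<cdot>\<^bsub>UP R\<^esub> ?X \<oplus>\<^bsub>UP R\<^esub> [(2::nat)] \<cdot>\<^bsub>UP R\<^esub> ?Y \<oplus>\<^bsub>UP R\<^esub> ?Z) n
       = ((if n \<in> Qm then of_Z4 R 2 else \<zero>) \<oplus> (if n \<in> Pm then of_Z4 R 2 else \<zero>)) \<oplus> up_ring.coeff (UP R) ?Z n"
      using XY Z double[OF finite_Qm, of n] double[OF finite_Pm, of n] unfolding X Y by simp
    show "up_ring.coeff (UP R) ?L n
      = up_ring.coeff (UP R) ([(2::nat)] \<cdot>\<^bsub>UP R\<^esub> ?X \<oplus>\<^bsub>UP R\<^esub> [(2::nat)] \<cdot>\<^bsub>UP R\<^esub> ?Y \<oplus>\<^bsub>UP R\<^esub> ?Z) n"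
    proof (cases "n < p * q")
      case False
      then have "n \<notin> Qm" "n \<notin> Pm" "n \<notin> (\<Union>m<4. cl m)"
        using residues_partition by blast+
      then show ?thesis unfolding sum L_coeff using False Z_zero by simp
    next
      case True
      then consider "n \<in> Qm \<union> Pm" | m where "m < 4" "n \<in> cl m"
        using residues_partition by blast
      then show ?thesis
      proof cases
        case 1
        \<comment> \<open>Exactly one of the first two sums contributes, so the coefficient is 2 and
          not 4 = 0; at n = 0 it is the first, as the second starts at j = 1.\<close>
        then have "n \<notin> (\<Union>m<4. cl m)" "n \<in> Qm \<longleftrightarrow> n \<notin> Pm"
          using Qm_Pm_class_disjoint Qm_Pm_disjoint by blast+
        then show ?thesis
          unfolding sum L_coeff c using True Z_zero ms_value_multiple[OF 1] by simp
      next
        case 2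
        then have "n \<notin> Qm" "n \<notin> Pm" using Qm_Pm_class_disjoint by blast+
        then show ?thesis
          unfolding sum L_coeff c using True Z_class[OF 2] ms_value_class_index[OF 2(2)] \<rho> by simp
      qed
    qed
  qed (use L XY Z in simp_all)
qed

theorem theorem2:
  fixes p q :: nat and g h :: int and f :: "nat \<Rightarrow> int" and \<beta> :: "(nat \<Rightarrow> int) set"
  assumes "Factorial_Ring.prime p" and "Factorial_Ring.prime q" and "p \<noteq> q"
    and "gcd (p - 1) (q - 1) = 4"
    and "residue_primroot p (nat (g mod int p))"
    and "residue_primroot q (nat (g mod int q))"
    and "[h = g] (mod int p)" and "[h = 1] (mod int q)"
    and "basic_irreducible (ord (p * q) 2) f"
    and "primitive_root_of_unity (GR f) (p * q) \<beta>"
    and "[p = 1] (mod 8)" and "[q = 5] (mod 8)"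
  shows
    "let S = GR f;
         D = cyc_poly p q g h;
         ev = (\<lambda>a. eval Z4 S (of_Z4 S) \<beta> a);
         \<rho> = ev (D 1) \<oplus>\<^bsub>S\<^esub> [(2::nat)] \<cdot>\<^bsub>S\<^esub> ev (D 2) \<oplus>\<^bsub>S\<^esub> [(3::nat)] \<cdot>\<^bsub>S\<^esub> ev (D 3)
     in mattson_solomon S (p * q) (quat_seq p q g h) \<beta> =
          [(2::nat)] \<cdot>\<^bsub>UP S\<^esub> (\<Oplus>\<^bsub>UP S\<^esub> j \<in> {0..p - 1}. up_ring.monom (UP S) \<one>\<^bsub>S\<^esub> (j * q))
          \<oplus>\<^bsub>UP S\<^esub> [(2::nat)] \<cdot>\<^bsub>UP S\<^esub> (\<Oplus>\<^bsub>UP S\<^esub> j \<in> {1..q - 1}. up_ring.monom (UP S) \<one>\<^bsub>S\<^esub> (j * p))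
          \<oplus>\<^bsub>UP S\<^esub> (\<Oplus>\<^bsub>UP S\<^esub> k \<in> {0..3::nat}.
                 (\<rho> \<oplus>\<^bsub>S\<^esub> of_Z4 S (2 - int k)) \<odot>\<^bsub>UP S\<^esub> poly_of_Z4 S (D k))"
proof -
  define S where "S = GR f"
  define G where "G = nat (g mod int (p * q))"
  define H where "H = nat (h mod int (p * q))"
  have f: "f \<in> carrier (UP Z4)" using assms(9) by (simp add: basic_irreducible_def)
  have pq: "p > 1" "q > 1" using assms(1,2) prime_gt_1_nat by blast+
  have GH: "int G = g mod int (p * q)" "int H = h mod int (p * q)"
    using pq by (simp_all add: G_def H_def)
  \<comment> \<open>Reduction modulo \<open>p * q\<close> does not change residues modulo p or q, so
    \<open>G\<close> and \<open>H\<close> inherit the hypotheses on \<open>g\<close> and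
    \<open>h\<close> at both primes.\<close>
  have mm: "c mod int (p * q) mod int r = c mod int r" if "r dvd p * q" for c r
    using that by (intro mod_mod_cancel) (simp only: of_nat_dvd_iff)
  have "G mod r = nat (g mod int r)" if "r dvd p * q" for r
  proof -
    have "int (G mod r) = g mod int r" by (simp only: zmod_int GH mm[OF that])
    then show ?thesis by (metis nat_int)
  qed
  then have "residue_primroot p G" "residue_primroot q G"
    using assms(5,6) residue_primroot_mod[of p G] residue_primroot_mod[of q G] by (metis dvd_triv_left, metis dvd_triv_right)
  moreover have "[int H = int G] (mod int p)" "[int H = int 1] (mod int q)"
    using assms(7,8) unfolding GH cong_def mm[OF dvd_triv_left] mm[OF dvd_triv_right] by simp_all
  ultimately interpret cyclotomic_classes p q G H
    using assms(1-4) unfolding cong_int_iff by unfold_locales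
  have cl: "cyc_class p q g h i = cl i" for i
    unfolding cl_def e_def unfolding G_def H_def using pq by (intro cyc_class_eq_nat) simp
  interpret S: cring S unfolding S_def by (rule cring_GR[OF f])
  have root: "\<beta> \<in> Units S" "group.ord (units_of S) \<beta> = p * q"
    using assms(10) by (simp_all add: primitive_root_of_unity_def S_def)
  have pow_iff: "\<beta> [^]\<^bsub>S\<^esub> n = \<one>\<^bsub>S\<^esub> \<longleftrightarrow> p * q dvd n" for n :: nat
  proof -
    have "\<beta> [^]\<^bsub>units_of S\<^esub> n = \<one>\<^bsub>units_of S\<^esub> \<longleftrightarrow> p * q dvd n"
      using group.pow_eq_id[OF S.units_group, of \<beta> n] root by (simp add: units_of_carrier)
    then show ?thesis using S.units_of_pow[OF root(1)] by (simp add: units_of_one)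
  qed
  \<comment> \<open>The powers of \<open>\<beta>\<close> with exponents p and q are not 1, since the
    order \<open>p * q\<close> is larger than either exponent and so divides neither.\<close>
  interpret S: cyclotomic_root p q G H S \<beta>
  proof unfold_locales
    fix x assume x: "x \<in> carrier S"
    show "(x \<oplus>\<^bsub>S\<^esub> x) \<oplus>\<^bsub>S\<^esub> (x \<oplus>\<^bsub>S\<^esub> x) = \<zero>\<^bsub>S\<^esub>"
      using GR_quadruple[OF f] x unfolding S_def by blast
    show "x \<in> Units S \<or> (\<exists>y\<in>carrier S. x = y \<oplus>\<^bsub>S\<^esub> y)"
      using GR_unit_or_double[OF assms(9)] x unfolding S_def by blast
  qed (use root pq assms(11,12) in \<open>auto simp: pow_iff dest: dvd_imp_le\<close>)
  have Q: "{j * q |j. j \<in> {1..p - 1}} \<union> {0} = Qm"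
  proof -
    have "{..<p} = insert 0 {1..p - 1}" using pq by auto
    then have "Qm = insert 0 ((\<lambda>j. j * q) ` {1..p - 1})" unfolding Qm_def by (simp only: image_insert mult_0)
    then show ?thesis by (simp only: setcompr_eq_image Collect_mem_eq Un_insert_right Un_empty_right)
  qed
  have P: "{j * p |j. j \<in> {1..q - 1}} = Pm"
  proof -
    have "{1..<q} = {1..q - 1}" using pq by auto
    then show ?thesis unfolding Pm_def by (simp only: setcompr_eq_image Collect_mem_eq)
  qed
  have seq: "quat_seq p q g h u = (if u \<in> Qm then 2 else if u \<in> Pm then 0 else int (THE i. i < 4 \<and> u \<in> cl i))"
    if "u < p * q" for u
    unfolding quat_seq_def Let_def Q P cl using that by simp
  have lt: "u < p * q" if "u \<in> Qm \<union> Pm \<union> (\<Union>m<4. cl m)" for u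
    using that residues_partition by blast
  have "mattson_solomon S (p * q) (quat_seq p q g h) \<beta> =
          [(2::nat)] \<cdot>\<^bsub>UP S\<^esub> (\<Oplus>\<^bsub>UP S\<^esub> j \<in> {0..p - 1}. up_ring.monom (UP S) \<one>\<^bsub>S\<^esub> (j * q))
          \<oplus>\<^bsub>UP S\<^esub> [(2::nat)] \<cdot>\<^bsub>UP S\<^esub> (\<Oplus>\<^bsub>UP S\<^esub> j \<in> {1..q - 1}. up_ring.monom (UP S) \<one>\<^bsub>S\<^esub> (j * p))
          \<oplus>\<^bsub>UP S\<^esub> (\<Oplus>\<^bsub>UP S\<^esub> k \<in> {0..3::nat}.
                 (S.\<rho> \<oplus>\<^bsub>S\<^esub> of_Z4 S (2 - int k)) \<odot>\<^bsub>UP S\<^esub> poly_of_Z4 S (cyc_poly p q g h k))"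
  proof (rule S.mattson_solomon_eq)
    show "quat_seq p q g h u = 2" if "u \<in> Qm" for u
      using seq[of u] lt[of u] that by simp
    show "quat_seq p q g h u = 0" if "u \<in> Pm" for u
      using seq[of u] lt[of u] that Qm_Pm_disjoint by auto
    show "quat_seq p q g h u = int m" if "m < 4" "u \<in> cl m" for m u
    proof -
      have "u \<notin> Qm" "u \<notin> Pm" using that Qm_Pm_class_disjoint by blast+
      \<comment> \<open>Disjointness of the classes makes the index unique, so the definite
        description evaluates to \<open>m\<close>.\<close>
      moreover have "(THE i. i < 4 \<and> u \<in> cl i) = m"
        using that class_disjoint by (intro the_equality) blast+
      ultimately show ?thesis using seq[of u] lt[of u] that by auto
    qed
    show "cyc_poly p q g h k n = (if n \<in> cl k then 1 else 0)" for k n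
      using cyc_poly_apply[of p q g h k n] by (simp add: cl)
  qed
  moreover have "S.\<rho> = eval Z4 S (of_Z4 S) \<beta> (cyc_poly p q g h 1)
      \<oplus>\<^bsub>S\<^esub> [(2::nat)] \<cdot>\<^bsub>S\<^esub> eval Z4 S (of_Z4 S) \<beta> (cyc_poly p q g h 2)
      \<oplus>\<^bsub>S\<^esub> [(3::nat)] \<cdot>\<^bsub>S\<^esub> eval Z4 S (of_Z4 S) \<beta> (cyc_poly p q g h 3)"
  proof -
    have ev: "eval Z4 S (of_Z4 S) \<beta> (cyc_poly p q g h k) = S.E (cl k) \<beta>" for k
      using S.eval_cyc_poly[of p q g h k \<beta>] S.root_closed by (simp add: cl)
    have E: "S.E (cl k) \<beta> \<in> carrier S" for k using S.root_closed by simp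
    \<comment> \<open>Unfolding the four weights leaves the stated three-term expression, as the
      weight of \<open>cl 0\<close> is zero.\<close>
    have "{..<4::nat} = {0, 1, 2, 3}" by auto
    then have "S.\<rho> = of_Z4 S 0 \<otimes>\<^bsub>S\<^esub> S.E (cl 0) \<beta> \<oplus>\<^bsub>S\<^esub> (of_Z4 S 1 \<otimes>\<^bsub>S\<^esub> S.E (cl 1) \<beta> \<oplus>\<^bsub>S\<^esub>
        (of_Z4 S 2 \<otimes>\<^bsub>S\<^esub> S.E (cl 2) \<beta> \<oplus>\<^bsub>S\<^esub> of_Z4 S 3 \<otimes>\<^bsub>S\<^esub> S.E (cl 3) \<beta>))"
      using E by (simp add: S.\<rho>_def)
    then show ?thesis
      using E by (simp add: ev S.nat_add_pow_eq_of_Z4 S.a_assoc)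
  qed
  ultimately show ?thesis by (simp only: Let_def S_def)
qed

end
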